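(* Let $c_0<1$, $f\in\mathcal{M}^{-1}(L_c)$ and $\gamma\in(c_0-1,0)$, and let $(Ff)(z)=2\int_0^\infty x^{z/2}K_z(2\sqrt{x})f(x)\,dx$. Suppose that $$(Ff)(\gamma+i\tau)\in L_1\left(|\tau|>1;\ |\tau|^{\gamma+1/2}e^{\pi|\tau|/2}\,d\tau\right).$$ Then for all $t>0$ the following inversion formula holds: $$f(t)=\frac{1}{2\pi i}\int_{\gamma-i\infty}^{\gamma+i\infty}I_{-(1+z)}(2\sqrt{t})\,t^{-(1+z)/2}\,(Ff)(z)\,dz,$$ where the integral is absolutely convergent.
   Context: $K_z$ and $I_\nu$ are the modified Bessel functions of the second kind and first kind, respectively, of complex order (the paper calls $I_\nu$ the modified Bessel function of the third kind); in particular $I_{-(1+z)}(2\sqrt t)=\sum_{n=0}^\infty \frac{t^{n-(1+z)/2}}{n!\,\Gamma(n-z)}$. For $c_0\in\mathbb{R}$ let $c=\{s\in\mathbb{C}:\operatorname{Re} s=c_0\}$. $\mathcal{M}^{-1}(L_c)$ is the space of functions $f(x)$, $x\in\mathbb{R}_+=(0,\infty)$, representable in the form $f(x)=\frac{1}{2\pi i}\int_c f^*(s)x^{-s}\,ds$ with $f^*\in L_1(c)$. For such $f$ with $c_0<1$ the function $(Ff)(z)$ is defined for $\operatorname{Re} z>c_0-1$. *)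

theory Defs
  imports "HOL-Complex_Analysis.Complex_Analysis"
begin

text \<open>
  Modified Bessel function of the first kind, complex order, positive real argument
  (the value at \<open>x \<le> 0\<close> is irrelevant). The entire function \<open>rGamma\<close>, the reciprocal
  of the Gamma function, vanishes at the poles of \<open>Gamma\<close>, so every order is covered.
\<close>
definition bessel_I :: "complex \<Rightarrow> real \<Rightarrow> complex" where
  "bessel_I \<nu> x =
     (\<Sum>n. complex_of_real (x / 2) powr (2 * of_nat n + \<nu>) * rGamma (of_nat n + \<nu> + 1) / fact n)"

text \<open>
  Modified Bessel function of the second kind (Macdonald function), complex order, given
  for \<open>x > 0\<close> by its classical integral, which converges absolutely for every order \<open>z\<close>,
  integers included; its value at \<open>x \<le> 0\<close> is irrelevant.
\<close>
definition bessel_K :: "complex \<Rightarrow> real \<Rightarrow> complex" where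
  "bessel_K z x =
     (LINT u:{0..}|lborel. complex_of_real (exp (- x * cosh u)) * cosh (z * complex_of_real u))"

text \<open>
  Absolute integrability over, and integral along, the upward vertical line \<open>Re s = a\<close>,
  parametrised by \<open>s = a + \<i> \<tau>\<close>, so that \<open>ds = \<i> d\<tau>\<close>.
\<close>
definition L1_vline :: "real \<Rightarrow> (complex \<Rightarrow> complex) \<Rightarrow> bool" where
  "L1_vline a g \<longleftrightarrow> integrable lborel (\<lambda>\<tau>. g (Complex a \<tau>))"

definition vline_integral :: "real \<Rightarrow> (complex \<Rightarrow> complex) \<Rightarrow> complex" where
  "vline_integral a g = (LINT \<tau>|lborel. g (Complex a \<tau>) * \<i>)"

text \<open>
  The space \<open>M\<^sup>-\<^sup>1(L\<^sub>c)\<close> of inverse Mellin transforms of \<open>L\<^sub>1\<close> functions on the line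
  \<open>Re s = a\<close>. Its elements are functions on the positive half-line; the values of
  \<open>f\<close> at \<open>x \<le> 0\<close> are unconstrained.
\<close>
definition inv_mellin_L1 :: "real \<Rightarrow> (real \<Rightarrow> complex) set" where
  "inv_mellin_L1 a =
     {f. \<exists>fs. L1_vline a fs \<and>
         (\<forall>x>0. f x =
            1 / (2 * complex_of_real pi * \<i>) *
              vline_integral a (\<lambda>s. fs s * complex_of_real x powr (- s)))}"

definition F_transform :: "(real \<Rightarrow> complex) \<Rightarrow> complex \<Rightarrow> complex" where
  "F_transform f z =
     2 * (LINT x:{0<..}|lborel. complex_of_real x powr (z / 2) * bessel_K z (2 * sqrt x) * f x)"

end

theory Submission
  imports Defs "HOL-Probability.Characteristic_Functions"
begin

text \<open>
  Write \<open>Lf\<close> for the Laplace transform of \<open>f\<close>. The classical integral for \<open>K\<^sub>z\<close>, after the shift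
  \<open>u = v - ln x / 2\<close>, says \<open>2 x\<^bsup>z/2\<^esup> K\<^sub>z(2 \<surd>x) = \<integral> exp (z v - e\<^sup>v - x e\<^bsup>-v\<^esup>) dv\<close> over the
  whole line. Integrating against \<open>f\<close> first in \<open>x\<close> turns the index transform into
  \<open>(Ff)(\<gamma> + i \<tau>) = \<integral> e\<^bsup>i \<tau> v\<^esup> G(v) dv\<close> with \<open>G(v) = e\<^bsup>\<gamma> v\<^esup> exp (- e\<^sup>v) (Lf)(e\<^bsup>-v\<^esup>)\<close>.
  So \<open>(Ff)(\<gamma> + i \<tau>)\<close> is a Fourier transform (\<open>F_transform_vline\<close>), the weight in the hypothesis
  makes it integrable, and Fourier inversion (\<open>fourier_inversion\<close>), read at \<open>v = - ln p\<close>, gives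
  \<open>(Lf)(p) = (2 \<pi> i)\<^bsup>-1\<^esup> \<integral> e\<^bsup>1/p\<^esup> p\<^sup>z (Ff)(z) dz\<close> for every \<open>p > 0\<close>.

  On the other hand \<open>e\<^bsup>1/p\<^esup> p\<^sup>z\<close> is the Laplace transform of
  \<open>t\<^bsup>-(1+z)/2\<^esup> I\<^bsub>-(1+z)\<^esub>(2 \<surd>t)\<close>, as one sees by integrating the power series of \<open>I\<close> term by
  term (\<open>laplace_inv_kernel\<close>); this needs \<open>Re z < 0\<close>, which is why \<open>\<gamma> < 0\<close>. Hence \<open>f\<close> and the
  right-hand side of the inversion formula have the same Laplace transform, and being continuous
  they agree, by Lerch's theorem (\<open>laplace_injective\<close>).

  Exchanging the integrals, and already the absolute convergence, rests on two estimates: the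
  kernel of order \<open>z\<close> is at most the kernel of the real order \<open>Re z\<close> times a multiple of
  \<open>1 / \<bar>\<Gamma>(- z)\<bar>\<close> (\<open>norm_inv_kernel_le\<close>), and \<open>1 / \<bar>\<Gamma>(- \<gamma> - i \<tau>)\<bar>\<close> is
  \<open>O(\<bar>\<tau>\<bar>\<^bsup>\<gamma>+1/2\<^esup> e\<^bsup>\<pi>\<bar>\<tau>\<bar>/2\<^esup>)\<close>, as \<open>\<bar>\<tau>\<bar> \<rightarrow> \<infinity>\<close>, exactly the weight of the hypothesis.
  The exponents in the second bound are sharp. They are obtained without Stirling's formula
  (\<open>norm_rGamma_vline_le\<close>): the reflection formula gives \<open>\<bar>\<Gamma>(1/2 + i \<tau>)\<bar>\<close> exactly, the
  functional equation then gives \<open>\<bar>\<Gamma>(3/2 + i \<tau>)\<bar>\<close>, and in between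
  \<open>x \<mapsto> \<bar>\<Gamma>(x + i \<tau>)\<bar> / \<Gamma>(x)\<close> is log-concave because Euler's product writes it as a product of
  log-concave factors.
\<close>

section \<open>Parameter integrals on the real line\<close>

text \<open>Fubini's theorem in the form in which it is used throughout: absolute integrability on the
  product is replaced by a majorant whose two successive integrals can be computed.\<close>
lemma lborel_integral_swap_dominated:
  fixes K :: "real \<Rightarrow> real \<Rightarrow> complex" and B :: "real \<Rightarrow> real \<Rightarrow> real"
  assumes [measurable]: "(\<lambda>(x, y). K x y) \<in> borel_measurable (lborel \<Otimes>\<^sub>M lborel)"
    and bound: "\<And>x y. norm (K x y) \<le> B x y"
    and int_B: "\<And>x. integrable lborel (B x)"
    and int_int_B: "integrable lborel (\<lambda>x. LINT y|lborel. B x y)"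
  shows "(LINT x|lborel. LINT y|lborel. K x y) = (LINT y|lborel. LINT x|lborel. K x y)"
proof -
  have int_K: "integrable lborel (K x)" for x
    by (rule Bochner_Integration.integrable_bound[OF int_B[of x]]) (auto intro!: AE_I2 order_trans[OF bound])
  have "integrable lborel (\<lambda>x. LINT y|lborel. norm (K x y))"
  proof (rule Bochner_Integration.integrable_bound[OF int_int_B])
    have "(LINT y|lborel. norm (K x y)) \<le> (LINT y|lborel. B x y)" for x
      by (intro integral_mono integrable_norm int_K int_B bound)
    moreover have "0 \<le> (LINT y|lborel. norm (K x y))" for x
      by (rule Bochner_Integration.integral_nonneg) simp
    ultimately show "AE x in lborel. norm (LINT y|lborel. norm (K x y)) \<le> norm (LINT y|lborel. B x y)"
      unfolding real_norm_def by (intro AE_I2) (smt (verit, best))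
  qed simp
  then have "integrable (lborel \<Otimes>\<^sub>M lborel) (\<lambda>(x, y). K x y)"
    by (intro lborel_pair.Fubini_integrable) (auto simp: int_K)
  from lborel_pair.Fubini_integral[OF this] show ?thesis by simp
qed

text \<open>Dominated convergence along sequences. Asking for a majorant only near each point allows
  integrands with no integrable majorant that is uniform on all of \<open>S\<close>, such as
  \<open>exp (- p x) f(x)\<close> for \<open>p > 0\<close>.\<close>
lemma continuous_on_LINT_dominated:
  fixes K :: "real \<Rightarrow> real \<Rightarrow> complex"
  assumes meas: "\<And>x. x \<in> S \<Longrightarrow> K x \<in> borel_measurable lborel"
    and cont: "\<And>y. continuous_on S (\<lambda>x. K x y)"
    and dom: "\<And>a. a \<in> S \<Longrightarrow> \<exists>w. integrable lborel w \<and> (\<forall>\<^sub>F x in at a within S. \<forall>y. norm (K x y) \<le> w y)"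
  shows "continuous_on S (\<lambda>x. LINT y|lborel. K x y)"
  unfolding continuous_on_def
proof
  fix a assume a: "a \<in> S"
  then obtain w where w: "integrable lborel w" "\<forall>\<^sub>F x in at a within S. \<forall>y. norm (K x y) \<le> w y"
    using dom by blast
  show "((\<lambda>x. LINT y|lborel. K x y) \<longlongrightarrow> (LINT y|lborel. K a y)) (at a within S)"
    unfolding tendsto_at_iff_sequentially comp_def
  proof (intro allI impI)
    fix X :: "nat \<Rightarrow> real" assume X: "\<forall>i. X i \<in> S - {a}" "X \<longlonglongrightarrow> a"
    then have lim: "filterlim X (at a within S) sequentially" by (auto simp: filterlim_at)
    from eventually_compose_filterlim[OF w(2) this]
    obtain N where N: "\<And>n y. n \<ge> N \<Longrightarrow> norm (K (X n) y) \<le> w y"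
      by (auto simp: eventually_sequentially)
    have "(\<lambda>n. LINT y|lborel. K (X (n + N)) y) \<longlonglongrightarrow> (LINT y|lborel. K a y)"
    proof (rule integral_dominated_convergence[where w = w])
      show "AE y in lborel. (\<lambda>n. K (X (n + N)) y) \<longlonglongrightarrow> K a y"
      proof (rule AE_I2)
        fix y :: real
        have "((\<lambda>x. K x y) \<longlongrightarrow> K a y) (at a within S)"
          using cont[of y] a by (simp add: continuous_on_def)
        from filterlim_compose[OF this lim] show "(\<lambda>n. K (X (n + N)) y) \<longlonglongrightarrow> K a y"
          by (rule LIMSEQ_ignore_initial_segment)
      qed
      show "AE y in lborel. norm (K (X (n + N)) y) \<le> w y" for n
        by (intro AE_I2 N) simp
      show "K (X (n + N)) \<in> borel_measurable lborel" for n
        using X(1) by (intro meas) blast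
    qed (rule meas[OF a] w(1))+
    then show "(\<lambda>n. LINT y|lborel. K (X n) y) \<longlonglongrightarrow> (LINT y|lborel. K a y)"
      by (rule LIMSEQ_offset)
  qed
qed

lemma measurable_pos_continuous:
  fixes f :: "real \<Rightarrow> complex"
  assumes "continuous_on {0<..} f"
  shows "(\<lambda>x. indicator {0<..} x *\<^sub>R f x) \<in> borel_measurable borel"
  using assms by (intro borel_measurable_continuous_on_indicator) auto

section \<open>Fourier inversion\<close>

lemma integrable_gauss_scaled:
  assumes "s \<noteq> 0"
  shows "integrable lborel (\<lambda>x::real. exp (- (s * x)\<^sup>2 / 2))"
proof -
  have "integrable lborel (\<lambda>x. sqrt (2 * pi) * std_normal_density x)"
    by (intro integrable_mult_right) (use integrable_std_normal_moment[of 0] in simp)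
  then have "integrable lborel (\<lambda>x::real. exp (- x\<^sup>2 / 2))"
    by (simp add: std_normal_density_def)
  from lborel_integrable_real_affine[OF this assms, of 0] show ?thesis by simp
qed

lemma integral_gauss: "(LINT x|lborel. exp (- x\<^sup>2 / 2)) = sqrt (2 * pi)"
proof -
  have "(LINT x|lborel. sqrt (2 * pi) * std_normal_density x) = sqrt (2 * pi)"
    using integral_std_normal_moment_even[of 0] by simp
  then show ?thesis by (simp add: std_normal_density_def)
qed

text \<open>This is the characteristic function of the standard normal distribution.\<close>
lemma integral_gauss_iexp:
  "(LINT x|lborel. iexp (t * x) * complex_of_real (exp (- x\<^sup>2 / 2)))
     = complex_of_real (sqrt (2 * pi) * exp (- t\<^sup>2 / 2))"
proof -
  have "(LINT x|std_normal_distribution. iexp (t * x)) = complex_of_real (exp (- t\<^sup>2 / 2))"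
    using char_std_normal_distribution by (simp add: char_def fun_eq_iff)
  also have "(LINT x|std_normal_distribution. iexp (t * x))
     = (LINT x|lborel. std_normal_density x *\<^sub>R iexp (t * x))"
    by (intro integral_density) auto
  also have "\<dots> = (LINT x|lborel. complex_of_real (1 / sqrt (2 * pi))
       * (iexp (t * x) * complex_of_real (exp (- x\<^sup>2 / 2))))"
    by (intro Bochner_Integration.integral_cong)
       (auto simp: std_normal_density_def scaleR_conv_of_real field_simps)
  also have "\<dots> = complex_of_real (1 / sqrt (2 * pi))
       * (LINT x|lborel. iexp (t * x) * complex_of_real (exp (- x\<^sup>2 / 2)))"
    by (rule integral_mult_right_zero)
  finally show ?thesis by (simp add: field_simps)
qed

lemma integral_gauss_iexp_scaled:
  assumes "n > 0"
  shows "(LINT x|lborel. iexp (t * x) * complex_of_real (exp (- (x / n)\<^sup>2 / 2)))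
     = complex_of_real (n * sqrt (2 * pi) * exp (- (n * t)\<^sup>2 / 2))"
proof -
  have "(LINT x|lborel. iexp (t * x) * complex_of_real (exp (- (x / n)\<^sup>2 / 2)))
    = \<bar>n\<bar> *\<^sub>R (LINT x|lborel. iexp (t * (0 + n * x)) * complex_of_real (exp (- ((0 + n * x) / n)\<^sup>2 / 2)))"
    using assms by (intro lborel_integral_real_affine) simp
  also have "(LINT x|lborel. iexp (t * (0 + n * x)) * complex_of_real (exp (- ((0 + n * x) / n)\<^sup>2 / 2)))
    = (LINT x|lborel. iexp ((n * t) * x) * complex_of_real (exp (- x\<^sup>2 / 2)))"
    using assms by (simp add: mult_ac)
  also have "\<dots> = complex_of_real (sqrt (2 * pi) * exp (- (n * t)\<^sup>2 / 2))"
    by (rule integral_gauss_iexp)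
  finally show ?thesis using assms by (simp add: scaleR_conv_of_real)
qed

text \<open>Damping \<open>\<Phi>\<close> by the Gaussian \<open>exp (- (\<tau> / n)\<^sup>2 / 2)\<close> makes the double integral absolutely
  convergent, so that Fubini applies and turns the damped integral into the average of \<open>G\<close>
  against a Gaussian of width \<open>1/n\<close> around \<open>v\<close>. As \<open>n\<close> grows, the damped side tends to the
  undamped integral because \<open>\<Phi>\<close> is integrable, and the average tends to \<open>G v\<close> because \<open>G\<close> is
  bounded and continuous.\<close>
theorem fourier_inversion:
  fixes G \<Phi> :: "real \<Rightarrow> complex"
  assumes int_G: "integrable lborel G" and cont_G: "continuous_on UNIV G"
    and bound_G: "\<And>v. norm (G v) \<le> B"
    and \<Phi>: "\<And>\<tau>. \<Phi> \<tau> = (LINT v|lborel. iexp (\<tau> * v) * G v)"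
    and int_\<Phi>: "integrable lborel \<Phi>"
  shows "(LINT \<tau>|lborel. \<Phi> \<tau> * iexp (- (\<tau> * v))) = complex_of_real (2 * pi) * G v"
proof -
  have [measurable]: "G \<in> borel_measurable borel" "\<Phi> \<in> borel_measurable borel"
    using int_G int_\<Phi> by (auto dest: borel_measurable_integrable)
  define I where "I n = (LINT \<tau>|lborel. \<Phi> \<tau> * iexp (- (\<tau> * v))
      * complex_of_real (exp (- (\<tau> / real (Suc n))\<^sup>2 / 2)))" for n
  have inv: "(\<lambda>n. 1 / real (Suc n)) \<longlonglongrightarrow> 0"
    using LIMSEQ_inverse_real_of_nat by (simp add: inverse_eq_divide)
  have "I \<longlonglongrightarrow> (LINT \<tau>|lborel. \<Phi> \<tau> * iexp (- (\<tau> * v)))"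
    unfolding I_def
  proof (rule integral_dominated_convergence[where w = "\<lambda>\<tau>. norm (\<Phi> \<tau>)"])
    show "AE \<tau> in lborel. (\<lambda>n. \<Phi> \<tau> * iexp (- (\<tau> * v))
        * complex_of_real (exp (- (\<tau> / real (Suc n))\<^sup>2 / 2))) \<longlonglongrightarrow> \<Phi> \<tau> * iexp (- (\<tau> * v))"
    proof (rule AE_I2)
      fix \<tau> :: real
      have "(\<lambda>n. \<Phi> \<tau> * iexp (- (\<tau> * v)) * complex_of_real (exp (- (\<tau> * (1 / real (Suc n)))\<^sup>2 / 2)))
          \<longlonglongrightarrow> \<Phi> \<tau> * iexp (- (\<tau> * v)) * complex_of_real (exp (- (\<tau> * 0)\<^sup>2 / 2))"
        by (intro tendsto_intros inv) auto
      then show "(\<lambda>n. \<Phi> \<tau> * iexp (- (\<tau> * v))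
        * complex_of_real (exp (- (\<tau> / real (Suc n))\<^sup>2 / 2))) \<longlonglongrightarrow> \<Phi> \<tau> * iexp (- (\<tau> * v))"
        by simp
    qed
    show "AE \<tau> in lborel. norm (\<Phi> \<tau> * iexp (- (\<tau> * v))
        * complex_of_real (exp (- (\<tau> / real (Suc n))\<^sup>2 / 2))) \<le> norm (\<Phi> \<tau>)" for n
      by (auto simp: norm_mult mult_left_le)
  qed (use int_\<Phi> in auto)
  moreover have "I n = complex_of_real (sqrt (2 * pi))
      * (LINT y|lborel. G (v + y / real (Suc n)) * complex_of_real (exp (- y\<^sup>2 / 2)))" for n
  proof -
    define m where "m = real (Suc n)"
    have m: "m > 0" by (simp add: m_def)
    have "I n = (LINT \<tau>|lborel. LINT w|lborel. iexp (\<tau> * (w - v)) * G w * complex_of_real (exp (- (\<tau> / m)\<^sup>2 / 2)))"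
      unfolding I_def \<Phi> m_def [symmetric]
      apply (intro Bochner_Integration.integral_cong refl)
      apply (subst integral_mult_left_zero [symmetric])+
      apply (intro Bochner_Integration.integral_cong refl)
      apply (simp add: algebra_simps exp_diff exp_minus field_simps)
      done
    also have "\<dots> = (LINT w|lborel. LINT \<tau>|lborel. iexp (\<tau> * (w - v)) * G w * complex_of_real (exp (- (\<tau> / m)\<^sup>2 / 2)))"
    proof (rule lborel_integral_swap_dominated[where B = "\<lambda>\<tau> w. norm (G w) * exp (- (\<tau> / m)\<^sup>2 / 2)"])
      show "integrable lborel (\<lambda>\<tau>. LINT w|lborel. norm (G w) * exp (- (\<tau> / m)\<^sup>2 / 2))"
        using integrable_gauss_scaled[of "1 / m"] m by (simp add: integrable_mult_right)
    qed (use int_G in \<open>auto simp: norm_mult\<close>)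
    also have "\<dots> = (LINT w|lborel. G w * (LINT \<tau>|lborel. iexp ((w - v) * \<tau>) * complex_of_real (exp (- (\<tau> / m)\<^sup>2 / 2))))"
      apply (intro Bochner_Integration.integral_cong refl)
      apply (subst integral_mult_right_zero [symmetric])
      apply (intro Bochner_Integration.integral_cong refl)
      apply (simp add: mult_ac)
      done
    also have "\<dots> = (LINT w|lborel. G w * complex_of_real (m * sqrt (2 * pi) * exp (- (m * (w - v))\<^sup>2 / 2)))"
      by (simp only: integral_gauss_iexp_scaled[OF m])
    also have "\<dots> = \<bar>1 / m\<bar> *\<^sub>R (LINT y|lborel. G (v + (1 / m) * y)
        * complex_of_real (m * sqrt (2 * pi) * exp (- (m * ((v + (1 / m) * y) - v))\<^sup>2 / 2)))"
      using m by (intro lborel_integral_real_affine) simp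
    also have "(LINT y|lborel. G (v + (1 / m) * y)
        * complex_of_real (m * sqrt (2 * pi) * exp (- (m * ((v + (1 / m) * y) - v))\<^sup>2 / 2)))
       = (LINT y|lborel. complex_of_real (m * sqrt (2 * pi))
          * (G (v + y / m) * complex_of_real (exp (- y\<^sup>2 / 2))))"
      using m by (simp add: mult_ac)
    also have "\<dots> = complex_of_real (m * sqrt (2 * pi))
          * (LINT y|lborel. G (v + y / m) * complex_of_real (exp (- y\<^sup>2 / 2)))"
      by (rule integral_mult_right_zero)
    finally show ?thesis using m unfolding m_def [symmetric] by (simp add: scaleR_conv_of_real)
  qed
  then have "I = (\<lambda>n. complex_of_real (sqrt (2 * pi))
      * (LINT y|lborel. G (v + y / real (Suc n)) * complex_of_real (exp (- y\<^sup>2 / 2))))" by auto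
  moreover have "(\<lambda>n. complex_of_real (sqrt (2 * pi))
      * (LINT y|lborel. G (v + y / real (Suc n)) * complex_of_real (exp (- y\<^sup>2 / 2))))
      \<longlonglongrightarrow> complex_of_real (sqrt (2 * pi)) * (LINT y|lborel. G v * complex_of_real (exp (- y\<^sup>2 / 2)))"
  proof (intro tendsto_mult tendsto_const
      integral_dominated_convergence[where w = "\<lambda>y. B * exp (- y\<^sup>2 / 2)"])
    show "integrable lborel (\<lambda>y. B * exp (- y\<^sup>2 / 2))"
      using integrable_gauss_scaled[of 1] by (intro integrable_mult_right) simp
    show "AE y in lborel. (\<lambda>n. G (v + y / real (Suc n)) * complex_of_real (exp (- y\<^sup>2 / 2)))
        \<longlonglongrightarrow> G v * complex_of_real (exp (- y\<^sup>2 / 2))"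
    proof (rule AE_I2)
      fix y :: real
      have "isCont G v" using cont_G by (simp add: continuous_on_eq_continuous_at)
      moreover have "(\<lambda>n. v + y * (1 / real (Suc n))) \<longlonglongrightarrow> v + y * 0"
        by (intro tendsto_intros inv)
      ultimately have "(\<lambda>n. G (v + y / real (Suc n))) \<longlonglongrightarrow> G v"
        by (auto intro: isCont_tendsto_compose)
      then show "(\<lambda>n. G (v + y / real (Suc n)) * complex_of_real (exp (- y\<^sup>2 / 2)))
        \<longlonglongrightarrow> G v * complex_of_real (exp (- y\<^sup>2 / 2))" by (intro tendsto_intros)
    qed
  qed (use bound_G in \<open>auto simp: norm_mult intro!: mult_right_mono\<close>)
  moreover have "(LINT y|lborel. G v * complex_of_real (exp (- y\<^sup>2 / 2)))
     = G v * complex_of_real (sqrt (2 * pi))"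
    by (simp only: integral_mult_right_zero integral_complex_of_real integral_gauss)
  ultimately have "(LINT \<tau>|lborel. \<Phi> \<tau> * iexp (- (\<tau> * v)))
      = complex_of_real (sqrt (2 * pi)) * (G v * complex_of_real (sqrt (2 * pi)))"
    by (metis LIMSEQ_unique)
  also have "\<dots> = complex_of_real (sqrt (2 * pi) * sqrt (2 * pi)) * G v"
    unfolding of_real_mult by (simp only: mult_ac)
  finally show ?thesis by simp
qed

section \<open>Injectivity of the Laplace transform\<close>

text \<open>In the variable \<open>x = exp (- t)\<close> the Laplace transform at \<open>p = k + 1\<close> is the \<open>k\<close>-th moment of
  \<open>exp (- t) E(t)\<close>. If all moments vanish, this function is orthogonal to every polynomial in \<open>x\<close>
  and, by Weierstrass approximation on \<open>{0..1}\<close>, to every continuous function of \<open>x\<close>.\<close>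
lemma laplace_zero_imp_test_zero:
  fixes E :: "real \<Rightarrow> real"
  assumes int: "\<And>p. p > 0 \<Longrightarrow> set_integrable lborel {0<..} (\<lambda>t. exp (- (p * t)) * E t)"
    and zero: "\<And>p. p > 0 \<Longrightarrow> (LINT t:{0<..}|lborel. exp (- (p * t)) * E t) = 0"
    and \<phi>: "continuous_on {0..1} \<phi>"
    and meas: "(\<lambda>t. \<phi> (exp (- t))) \<in> borel_measurable borel"
  shows "set_integrable lborel {0<..} (\<lambda>t. exp (- t) * E t * \<phi> (exp (- t)))"
    and "(LINT t:{0<..}|lborel. exp (- t) * E t * \<phi> (exp (- t))) = 0"
proof -
  let ?M = "\<lambda>t. exp (- t) * E t"
  have int_M: "set_integrable lborel {0<..} ?M" using int[of 1] by simp
  have [measurable]: "(\<lambda>t. indicator {0<..} t *\<^sub>R ?M t) \<in> borel_measurable borel"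
    using int_M unfolding set_integrable_def by (auto dest: borel_measurable_integrable)
  note [measurable] = meas
  obtain C where C: "\<And>x. x \<in> {0..1} \<Longrightarrow> \<bar>\<phi> x\<bar> \<le> C"
  proof -
    have "bounded (\<phi> ` {0..1})" by (intro compact_imp_bounded compact_continuous_image \<phi>) simp
    then obtain a where "\<forall>y\<in>\<phi> ` {0..1}. norm y \<le> a" unfolding bounded_iff by blast
    then show ?thesis by (intro that[of a]) auto
  qed
  show int_\<phi>: "set_integrable lborel {0<..} (\<lambda>t. ?M t * \<phi> (exp (- t)))"
    unfolding set_integrable_def
  proof (rule Bochner_Integration.integrable_bound)
    show "integrable lborel (\<lambda>t. C * (indicator {0<..} t *\<^sub>R ?M t))"
      using int_M unfolding set_integrable_def by (intro integrable_mult_right)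
    have "(\<lambda>t. (indicator {0<..} t *\<^sub>R ?M t) * \<phi> (exp (- t))) \<in> borel_measurable lborel"
      by measurable
    then show "(\<lambda>t. indicator {0<..} t *\<^sub>R (?M t * \<phi> (exp (- t)))) \<in> borel_measurable lborel"
      by (simp add: mult_ac)
    show "AE t in lborel. norm (indicator {0<..} t *\<^sub>R (?M t * \<phi> (exp (- t))))
        \<le> norm (C * (indicator {0<..} t *\<^sub>R ?M t))"
    proof (rule AE_I2)
      fix t :: real
      have "\<bar>\<phi> (exp (- t))\<bar> \<le> \<bar>C\<bar>" if "t > 0" using C[of "exp (- t)"] that by auto
      then have "\<bar>?M t\<bar> * \<bar>\<phi> (exp (- t))\<bar> \<le> \<bar>?M t\<bar> * \<bar>C\<bar>" if "t > 0"
        using that by (intro mult_left_mono) auto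
      then show "norm (indicator {0<..} t *\<^sub>R (?M t * \<phi> (exp (- t))))
        \<le> norm (C * (indicator {0<..} t *\<^sub>R ?M t))"
        by (auto simp: indicator_def abs_mult mult_ac)
    qed
  qed
  have pow: "set_integrable lborel {0<..} (\<lambda>t. ?M t * exp (- t) ^ k)"
            "(LINT t:{0<..}|lborel. ?M t * exp (- t) ^ k) = 0" for k
  proof -
    have "exp (- (real (Suc k) * t)) = exp (- t) ^ Suc k" for t
      using exp_of_nat_mult[of "Suc k" "- t"] by (simp only: mult_minus_right)
    then have "?M t * exp (- t) ^ k = exp (- (real (Suc k) * t)) * E t" for t
      by (simp only: power_Suc mult_ac)
    then show "set_integrable lborel {0<..} (\<lambda>t. ?M t * exp (- t) ^ k)"
            "(LINT t:{0<..}|lborel. ?M t * exp (- t) ^ k) = 0"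
      using int[of "real (Suc k)", OF of_nat_0_less_iff[THEN iffD2, OF zero_less_Suc]]
        zero[of "real (Suc k)", OF of_nat_0_less_iff[THEN iffD2, OF zero_less_Suc]]
      by (simp_all only:)
  qed
  define J where "J = (LINT t:{0<..}|lborel. \<bar>?M t\<bar>)"
  have J: "J \<ge> 0" unfolding J_def set_lebesgue_integral_def by (intro Bochner_Integration.integral_nonneg) auto
  have "\<bar>LINT t:{0<..}|lborel. ?M t * \<phi> (exp (- t))\<bar> \<le> e" if "e > 0" for e
  proof -
    define d where "d = e / (J + 1)"
    have d: "d > 0" using that J by (simp add: d_def)
    obtain q :: "real \<Rightarrow> real" where q: "polynomial_function q" "\<And>x. x \<in> {0..1} \<Longrightarrow> norm (\<phi> x - q x) < d"
      using Stone_Weierstrass_polynomial_function[OF _ \<phi> d] by auto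
    then obtain a n where qa: "q = (\<lambda>x. \<Sum>i\<le>n. a i * x ^ i)"
      using real_polynomial_function_iff_sum real_polynomial_function_eq by metis
    have q_eq: "indicator {0<..} t *\<^sub>R (?M t * q (exp (- t)))
        = (\<Sum>i\<le>n. a i * (indicator {0<..} t *\<^sub>R (?M t * exp (- t) ^ i)))" for t
      by (simp add: qa sum_distrib_left mult_ac)
    have int_q: "set_integrable lborel {0<..} (\<lambda>t. ?M t * q (exp (- t)))"
      using pow(1) unfolding set_integrable_def q_eq
      by (intro Bochner_Integration.integrable_sum integrable_mult_right)
    have "(LINT t:{0<..}|lborel. ?M t * q (exp (- t)))
        = (\<Sum>i\<le>n. a i * (LINT t:{0<..}|lborel. ?M t * exp (- t) ^ i))"
      using pow(1) unfolding set_integrable_def set_lebesgue_integral_def q_eq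
      by (simp only: Bochner_Integration.integral_sum integrable_mult_right integral_mult_right_zero)
    also have "\<dots> = 0" using pow(2) by simp
    finally have "(LINT t:{0<..}|lborel. ?M t * q (exp (- t))) = 0" .
    then have diff: "(LINT t:{0<..}|lborel. ?M t * \<phi> (exp (- t)))
        = (LINT t:{0<..}|lborel. ?M t * \<phi> (exp (- t)) - ?M t * q (exp (- t)))"
      using int_q int_\<phi> by (simp add: set_integral_diff)
    have "\<bar>LINT t:{0<..}|lborel. ?M t * \<phi> (exp (- t))\<bar>
        \<le> (LINT t:{0<..}|lborel. \<bar>?M t * \<phi> (exp (- t)) - ?M t * q (exp (- t))\<bar>)"
      unfolding diff using set_integral_norm_bound[OF set_integral_diff(1)[OF int_\<phi> int_q]] by simp
    also have "\<dots> \<le> (LINT t:{0<..}|lborel. d * \<bar>?M t\<bar>)"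
    proof (rule set_integral_mono)
      show "set_integrable lborel {0<..} (\<lambda>t. \<bar>?M t * \<phi> (exp (- t)) - ?M t * q (exp (- t))\<bar>)"
        using set_integrable_norm[OF set_integral_diff(1)[OF int_\<phi> int_q]] by (simp only: real_norm_def)
      show "set_integrable lborel {0<..} (\<lambda>t. d * \<bar>?M t\<bar>)"
        using set_integrable_norm[OF int_M] unfolding real_norm_def by (rule set_integrable_mult_right)
      fix t :: real assume "t \<in> {0<..}"
      then have "\<bar>\<phi> (exp (- t)) - q (exp (- t))\<bar> \<le> d" using q(2)[of "exp (- t)"] by auto
      then have "\<bar>?M t\<bar> * \<bar>\<phi> (exp (- t)) - q (exp (- t))\<bar> \<le> \<bar>?M t\<bar> * d" by (intro mult_left_mono) auto
      then show "\<bar>?M t * \<phi> (exp (- t)) - ?M t * q (exp (- t))\<bar> \<le> d * \<bar>?M t\<bar>"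
        unfolding right_diff_distrib [symmetric] abs_mult by (simp only: mult.commute)
    qed
    also have "\<dots> = d * J" by (simp add: J_def)
    also have "\<dots> \<le> e" using J that by (simp add: d_def field_simps)
    finally show ?thesis .
  qed
  then have "\<bar>LINT t:{0<..}|lborel. ?M t * \<phi> (exp (- t))\<bar> \<le> 0" by (rule field_le_epsilon) simp
  then show "(LINT t:{0<..}|lborel. ?M t * \<phi> (exp (- t))) = 0" by simp
qed

text \<open>If \<open>E\<close> were positive at \<open>t0\<close>, it would be positive near \<open>t0\<close>; testing against a tent function
  supported there gives a vanishing integral of a nonnegative function that is positive on an open
  set.\<close>
lemma laplace_zero_imp_nonpos:
  fixes E :: "real \<Rightarrow> real"
  assumes int: "\<And>p. p > 0 \<Longrightarrow> set_integrable lborel {0<..} (\<lambda>t. exp (- (p * t)) * E t)"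
    and zero: "\<And>p. p > 0 \<Longrightarrow> (LINT t:{0<..}|lborel. exp (- (p * t)) * E t) = 0"
    and cont: "continuous_on {0<..} E"
    and t0: "t0 > 0"
  shows "E t0 \<le> 0"
proof (rule ccontr)
  assume "\<not> E t0 \<le> 0"
  then have pos: "E t0 > 0" by simp
  define x0 where "x0 = exp (- t0)"
  have x0: "0 < x0" "x0 < 1" using t0 by (auto simp: x0_def)
  have "isCont E t0" using cont t0 by (simp add: continuous_on_eq_continuous_at)
  then have "isCont (\<lambda>x. E (- ln x)) x0"
    using x0 by (intro isCont_o2[where g = E and f = "\<lambda>x. - ln x"] isCont_minus isCont_ln) (simp_all add: x0_def)
  then have "((\<lambda>x. E (- ln x)) \<longlongrightarrow> E (- ln x0)) (nhds x0)"
    unfolding isCont_def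
    by (rule tendsto_at_iff_tendsto_nhds[where g = "\<lambda>x. E (- ln x)", THEN iffD1])
  moreover have "E (- ln x0) > 0" using pos by (simp add: x0_def)
  ultimately have "eventually (\<lambda>x. E (- ln x) > 0) (nhds x0)" by (rule order_tendstoD(1))
  then obtain d0 where d0: "d0 > 0" "\<And>x. dist x x0 < d0 \<Longrightarrow> E (- ln x) > 0"
    by (auto simp: eventually_nhds_metric)
  define d where "d = min d0 (1 - x0)"
  have d: "d > 0" using d0 x0 by (simp add: d_def)
  have E_pos: "t > 0" "E t > 0" if "\<bar>exp (- t) - x0\<bar> < d" for t
  proof -
    show "E t > 0" using d0(2)[of "exp (- t)"] that by (simp add: dist_real_def d_def)
    have "exp (- t) < 1" using that unfolding d_def by linarith
    then show "t > 0" by (simp only: exp_less_one_iff neg_less_0_iff_less)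
  qed
  \<comment> \<open>The tent is supported where \<open>E\<close> is positive; \<open>d \<le> 1 - x0\<close> keeps its support inside \<open>x < 1\<close>, that is, \<open>t > 0\<close>.\<close>
  define \<phi> where "\<phi> = (\<lambda>x. max 0 (d - \<bar>x - x0\<bar>))"
  let ?h = "\<lambda>t. exp (- t) * E t * \<phi> (exp (- t))"
  have cont_\<phi>: "continuous_on A \<phi>" for A
    unfolding \<phi>_def by (intro continuous_intros)
  have meas: "(\<lambda>t. \<phi> (exp (- t))) \<in> borel_measurable borel" by (simp add: \<phi>_def)
  note * = laplace_zero_imp_test_zero[OF int zero cont_\<phi> meas]
  have h_nonneg: "?h t \<ge> 0" for t
  proof (cases "\<bar>exp (- t) - x0\<bar> < d")
    case True
    then show ?thesis using E_pos(2)[OF True] by (simp add: \<phi>_def)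
  next
    case False
    then show ?thesis by (simp add: \<phi>_def)
  qed
  have "AE t in lborel. indicator {0<..} t *\<^sub>R ?h t = 0"
    using * h_nonneg unfolding set_integrable_def set_lebesgue_integral_def
    by (subst integral_nonneg_eq_0_iff_AE [symmetric]) (auto intro!: AE_I2 scaleR_nonneg_nonneg)
  then have "AE t in lborel. t \<notin> {t. \<bar>exp (- t) - x0\<bar> < d}"
  proof eventually_elim
    case (elim t)
    show ?case
    proof
      assume "t \<in> {t. \<bar>exp (- t) - x0\<bar> < d}"
      then have "\<bar>exp (- t) - x0\<bar> < d" by simp
      with E_pos[OF this] elim show False by (auto simp: \<phi>_def max_def)
    qed
  qed
  moreover have op: "open {t. \<bar>exp (- t) - x0\<bar> < d}"
    by (intro open_Collect_less continuous_intros)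
  ultimately have "{t. \<bar>exp (- t) - x0\<bar> < d} \<in> null_sets lborel"
    by (subst (asm) AE_iff_null_sets [symmetric]) auto
  then have "negligible {t. \<bar>exp (- t) - x0\<bar> < d}"
    by (simp add: negligible_iff_null_sets null_sets_completionI)
  moreover have "t0 \<in> {t. \<bar>exp (- t) - x0\<bar> < d}" using d by (simp add: x0_def)
  ultimately show False using open_not_negligible[OF op] by auto
qed

text \<open>Lerch's theorem for continuous functions. It follows from the one-sided real statement, applied
  to the real and imaginary parts of \<open>D\<close> and to their negatives.\<close>
theorem laplace_injective:
  fixes D :: "real \<Rightarrow> complex"
  assumes int: "\<And>p. p > 0 \<Longrightarrow> set_integrable lborel {0<..} (\<lambda>t. complex_of_real (exp (- (p * t))) * D t)"
    and zero: "\<And>p. p > 0 \<Longrightarrow> (LINT t:{0<..}|lborel. complex_of_real (exp (- (p * t))) * D t) = 0"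
    and cont: "continuous_on {0<..} D"
    and t0: "t0 > 0"
  shows "D t0 = 0"
proof -
  have part: "L (D t0) \<le> 0" if L: "bounded_linear L" and lin: "\<And>r z. L (complex_of_real r * z) = r * L z" for L :: "complex \<Rightarrow> real"
  proof (rule laplace_zero_imp_nonpos[where E = "\<lambda>t. L (D t)"])
    have *: "indicator {0<..} t *\<^sub>R (exp (- (p * t)) * L (D t))
       = L (indicator {0<..} t *\<^sub>R (complex_of_real (exp (- (p * t))) * D t))" for p t
      by (simp add: indicator_def lin linear_0[OF bounded_linear.linear[OF L]])
    show "set_integrable lborel {0<..} (\<lambda>t. exp (- (p * t)) * L (D t))" if p: "p > 0" for p
      using int[OF p] unfolding set_integrable_def * by (rule integrable_bounded_linear[OF L])
    show "(LINT t:{0<..}|lborel. exp (- (p * t)) * L (D t)) = 0" if p: "p > 0" for p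
      using int[OF p] zero[OF p] unfolding set_integrable_def set_lebesgue_integral_def *
      by (subst integral_bounded_linear[OF L]) (simp_all add: linear_0[OF bounded_linear.linear[OF L]])
    show "continuous_on {0<..} (\<lambda>t. L (D t))"
      by (rule bounded_linear.continuous_on[OF L cont])
  qed (rule t0)
  have "Re (D t0) \<le> 0" "- Re (D t0) \<le> 0" "Im (D t0) \<le> 0" "- Im (D t0) \<le> 0"
    using part[of Re] part[of "\<lambda>z. - Re z"] part[of Im] part[of "\<lambda>z. - Im z"]
    by (auto intro: bounded_linear_Re bounded_linear_Im bounded_linear_minus)
  then show ?thesis by (simp add: complex_eq_iff)
qed

section \<open>Growth of the reciprocal Gamma function on vertical lines\<close>

text \<open>The function is \<open>- 2 ln (u / \<bar>u + i \<tau>\<bar>)\<close>, that is, minus two times the logarithm of one factor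
  of Euler's product for \<open>\<bar>\<Gamma>(u + i \<tau>)\<bar> / \<Gamma>(u)\<close>.\<close>
lemma convex_on_ln_ratio:
  fixes \<tau> :: real
  shows "convex_on {0<..} (\<lambda>u. ln (u\<^sup>2 + \<tau>\<^sup>2) - 2 * ln u)"
proof (rule f''_ge0_imp_convex[where f' = "\<lambda>u. 2 * u / (u\<^sup>2 + \<tau>\<^sup>2) - 2 / u"
      and f'' = "\<lambda>u. 2 * (\<tau>\<^sup>2 - u\<^sup>2) / (u\<^sup>2 + \<tau>\<^sup>2)\<^sup>2 + 2 / u\<^sup>2"])
  fix u :: real assume "u \<in> {0<..}"
  then have u: "u > 0" by simp
  then have pos: "u\<^sup>2 + \<tau>\<^sup>2 > 0" by (simp add: add_pos_nonneg)
  show "((\<lambda>u. ln (u\<^sup>2 + \<tau>\<^sup>2) - 2 * ln u) has_real_derivative 2 * u / (u\<^sup>2 + \<tau>\<^sup>2) - 2 / u) (at u)"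
    using u pos by (auto intro!: derivative_eq_intros)
  have "((\<lambda>u. 2 * u / (u\<^sup>2 + \<tau>\<^sup>2) - 2 / u) has_real_derivative
      (2 * (u\<^sup>2 + \<tau>\<^sup>2) - 2 * u * (2 * u)) / ((u\<^sup>2 + \<tau>\<^sup>2) * (u\<^sup>2 + \<tau>\<^sup>2)) + 2 / (u * u)) (at u)"
    by (rule derivative_eq_intros refl | use u pos in simp)+
  moreover have "2 * (u\<^sup>2 + \<tau>\<^sup>2) - 2 * u * (2 * u) = 2 * (\<tau>\<^sup>2 - u\<^sup>2)"
    by (simp add: power2_eq_square)
  ultimately show "((\<lambda>u. 2 * u / (u\<^sup>2 + \<tau>\<^sup>2) - 2 / u) has_real_derivative
      2 * (\<tau>\<^sup>2 - u\<^sup>2) / (u\<^sup>2 + \<tau>\<^sup>2)\<^sup>2 + 2 / u\<^sup>2) (at u)"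
    by (simp only: power2_eq_square)
  have "0 \<le> 2 * (u\<^sup>2 * \<tau>\<^sup>2 * 3 + (\<tau>\<^sup>2)\<^sup>2)" by simp
  also have "\<dots> = 2 * (\<tau>\<^sup>2 - u\<^sup>2) * u\<^sup>2 + 2 * (u\<^sup>2 + \<tau>\<^sup>2)\<^sup>2"
    by (simp add: power2_eq_square algebra_simps)
  finally show "0 \<le> 2 * (\<tau>\<^sup>2 - u\<^sup>2) / (u\<^sup>2 + \<tau>\<^sup>2)\<^sup>2 + 2 / u\<^sup>2"
    using u pos by (simp add: field_simps)
qed simp

lemma cmod_ratio_log_concave:
  fixes x y \<tau> :: real
  assumes "x > 0" "y > 0" "0 \<le> l" "l \<le> 1"
  defines "r \<equiv> (\<lambda>u. u / cmod (Complex u \<tau>))"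
  shows "r x powr (1 - l) * r y powr l \<le> r ((1 - l) * x + l * y)"
proof -
  define h where "h = (\<lambda>u. ln (u\<^sup>2 + \<tau>\<^sup>2) - 2 * ln u)"
  have r: "r u = exp (- h u / 2)" if "u > 0" for u
  proof -
    have "u\<^sup>2 + \<tau>\<^sup>2 > 0" using that by (simp add: add_pos_nonneg)
    then have "exp (ln (u\<^sup>2 + \<tau>\<^sup>2) / 2) = sqrt (u\<^sup>2 + \<tau>\<^sup>2)"
      by (simp add: ln_sqrt [symmetric])
    moreover have "- h u / 2 = ln u - ln (u\<^sup>2 + \<tau>\<^sup>2) / 2" by (simp add: h_def field_simps)
    ultimately show ?thesis using that by (simp add: r_def cmod_def exp_diff)
  qed
  have z: "(1 - l) * x + l * y > 0"
    using assms(1-4) by (cases "l = 0") (auto intro!: add_nonneg_pos mult_nonneg_nonneg mult_pos_pos)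
  have "h ((1 - l) *\<^sub>R x + l *\<^sub>R y) \<le> (1 - l) * h x + l * h y"
    using convex_onD[OF convex_on_ln_ratio[of \<tau>], of l x y] assms(1-4) by (simp add: h_def)
  moreover have "r x powr (1 - l) * r y powr l = exp (- ((1 - l) * h x + l * h y) / 2)"
    using assms(1-4) by (simp add: r powr_def exp_add [symmetric] field_simps)
  ultimately show ?thesis using z by (simp add: r)
qed

text \<open>By Euler's limit, \<open>\<bar>\<Gamma>(u + i \<tau>)\<bar> / \<Gamma>(u)\<close> is the limit of the products of
  \<open>(u + k) / \<bar>u + k + i \<tau>\<bar>\<close> over \<open>k \<le> n\<close>, since the factors \<open>n\<^sup>u\<close> and \<open>n!\<close> cancel. Log-concavity
  of the factors passes to the products and to the limit.\<close>
lemma cmod_Gamma_ratio_log_concave: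
  fixes x y \<tau> :: real
  assumes x: "x > 0" and y: "y > 0" and l: "0 \<le> l" "l \<le> 1"
  defines "R \<equiv> (\<lambda>u. cmod (Gamma (Complex u \<tau>)) / Gamma u)"
  shows "R x powr (1 - l) * R y powr l \<le> R ((1 - l) * x + l * y)"
proof -
  define S where "S = (\<lambda>n u. cmod (Gamma_series (Complex u \<tau>) n) / Gamma_series u n)"
  have S: "S n u = (\<Prod>k\<le>n. (u + real k) / cmod (Complex (u + real k) \<tau>))" if "u > 0" "n > 0" for n u
  proof -
    have "cmod (exp (Complex u \<tau> * complex_of_real (ln (real n)))) = exp (u * ln (real n))"
      by simp
    moreover have "Complex u \<tau> + of_nat k = Complex (u + real k) \<tau>" for k
      by (simp add: complex_eq_iff)
    then have "cmod (pochhammer (Complex u \<tau>) (Suc n)) = (\<Prod>k\<le>n. cmod (Complex (u + real k) \<tau>))"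
      by (simp only: pochhammer_Suc_prod prod_norm [symmetric] atLeast0AtMost)
    moreover have "pochhammer u (Suc n) = (\<Prod>k\<le>n. u + real k)"
      by (simp add: pochhammer_Suc_prod atLeast0AtMost)
    ultimately show ?thesis
      by (simp add: S_def Gamma_series_def norm_mult norm_divide prod_dividef del: pochhammer_Suc)
  qed
  have lim: "(\<lambda>n. S n u) \<longlonglongrightarrow> R u" if "u > 0" for u
    unfolding S_def R_def using Gamma_real_pos[OF that]
    by (intro tendsto_intros Gamma_series_LIMSEQ) auto
  have R_pos: "R u > 0" if "u > 0" for u
  proof -
    have "Complex u \<tau> \<notin> \<int>\<^sub>\<le>\<^sub>0" using that by (auto simp: nonpos_Ints_def complex_eq_iff)
    then show ?thesis using that Gamma_real_pos[of u] by (auto simp: R_def Gamma_eq_zero_iff)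
  qed
  have z: "(1 - l) * x + l * y > 0"
    using assms(1-4) by (cases "l = 0") (auto intro!: add_nonneg_pos mult_nonneg_nonneg mult_pos_pos)
  show ?thesis
  proof (rule LIMSEQ_le)
    show "(\<lambda>n. S n ((1 - l) * x + l * y)) \<longlonglongrightarrow> R ((1 - l) * x + l * y)" by (rule lim[OF z])
    show "(\<lambda>n. S n x powr (1 - l) * S n y powr l) \<longlonglongrightarrow> R x powr (1 - l) * R y powr l"
      using R_pos[OF x] R_pos[OF y] by (intro tendsto_intros lim x y) auto
    have "S n x powr (1 - l) * S n y powr l \<le> S n ((1 - l) * x + l * y)" if n: "n \<ge> 1" for n
    proof -
      have "S n x powr (1 - l) * S n y powr l =
         (\<Prod>k\<le>n. ((x + real k) / cmod (Complex (x + real k) \<tau>)) powr (1 - l)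
              * ((y + real k) / cmod (Complex (y + real k) \<tau>)) powr l)"
        using n x y by (simp add: S prod_powr_distrib prod.distrib)
      also have "\<dots> \<le> (\<Prod>k\<le>n. ((1 - l) * (x + real k) + l * (y + real k))
           / cmod (Complex ((1 - l) * (x + real k) + l * (y + real k)) \<tau>))"
        using x y l by (intro prod_mono conjI cmod_ratio_log_concave) (auto intro!: mult_nonneg_nonneg)
      also have "\<dots> = (\<Prod>k\<le>n. ((1 - l) * x + l * y + real k)
           / cmod (Complex ((1 - l) * x + l * y + real k) \<tau>))"
        by (intro prod.cong refl) (simp add: algebra_simps)
      also have "\<dots> = S n ((1 - l) * x + l * y)" using n z by (simp add: S)
      finally show ?thesis .
    qed
    then show "\<exists>N. \<forall>n\<ge>N. S n x powr (1 - l) * S n y powr l \<le> S n ((1 - l) * x + l * y)" by blast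
  qed
qed

text \<open>On the line \<open>Re s = 1/2\<close> conjugation is \<open>s \<mapsto> 1 - s\<close>, so the reflection formula gives
  \<open>\<bar>\<Gamma>(s)\<bar>\<^sup>2\<close>.\<close>
lemma cmod_Gamma_half: "(cmod (Gamma (Complex (1/2) \<tau>)))\<^sup>2 = pi / cosh (pi * \<tau>)"
proof -
  let ?s = "Complex (1/2) \<tau>"
  have "cnj ?s = 1 - ?s" by (simp add: complex_eq_iff)
  then have "complex_of_real ((cmod (Gamma ?s))\<^sup>2) = Gamma ?s * Gamma (1 - ?s)"
    using complex_norm_square[of "Gamma ?s"] by (simp add: cnj_Gamma)
  also have "\<dots> = of_real pi / sin (of_real pi * ?s)" by (rule Gamma_reflection_complex)
  also have "of_real pi * ?s = of_real pi / 2 - (- (\<i> * of_real (pi * \<tau>)))" by (simp add: complex_eq_iff)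
  also have "sin \<dots> = cos (- (\<i> * of_real (pi * \<tau>)))"
    by (rule cos_sin_eq [symmetric])
  also have "\<dots> = of_real (cosh (pi * \<tau>))"
    by (simp add: cosh_def cos_exp_eq scaleR_conv_of_real field_simps flip: exp_of_real)
  finally show ?thesis by (simp only: of_real_divide [symmetric] of_real_eq_iff)
qed

lemma cmod_Gamma_half_ge: "cmod (Gamma (Complex (1/2) \<tau>)) \<ge> exp (- (pi * \<bar>\<tau>\<bar> / 2))"
proof -
  have "cosh (pi * \<tau>) \<le> exp (pi * \<bar>\<tau>\<bar>)"
    unfolding cosh_def by (cases "\<tau> \<ge> 0") (auto simp: exp_le_cancel_iff mult_le_0_iff field_simps intro!: add_mono[of "exp _" _ "exp _", unfolded mult_2 [symmetric]])
  also have "\<dots> \<le> pi * exp (pi * \<bar>\<tau>\<bar>)" using pi_ge_two by simp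
  finally have "pi / cosh (pi * \<tau>) \<ge> exp (- (pi * \<bar>\<tau>\<bar>))"
    by (simp add: field_simps exp_minus cosh_real_pos)
  also have "exp (- (pi * \<bar>\<tau>\<bar>)) = (exp (- (pi * \<bar>\<tau>\<bar> / 2)))\<^sup>2"
    by (simp add: exp_double [symmetric])
  finally show ?thesis by (simp add: cmod_Gamma_half [symmetric] power2_le_iff_abs_le)
qed

text \<open>Log-concavity bounds the ratio \<open>R(x) = \<bar>\<Gamma>(x + i \<tau>)\<bar> / \<Gamma>(x)\<close> from below by the geometric
  interpolation of its values at \<open>1/2\<close> and \<open>3/2\<close>, and the second value is at least \<open>\<bar>\<tau>\<bar>\<close> times the
  first. Interpolation thus produces the factor \<open>\<bar>\<tau>\<bar>\<close> to the power \<open>x - 1/2\<close>.\<close>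
lemma cmod_Gamma_strip_ge:
  fixes x \<tau> :: real
  assumes x: "1/2 \<le> x" "x \<le> 3/2" and \<tau>: "\<bar>\<tau>\<bar> \<ge> 1"
  shows "Gamma x / 2 * (\<bar>\<tau>\<bar> powr (x - 1/2) * exp (- (pi * \<bar>\<tau>\<bar> / 2))) \<le> cmod (Gamma (Complex x \<tau>))"
proof -
  define R where "R = (\<lambda>u. cmod (Gamma (Complex u \<tau>)) / Gamma u)"
  define l where "l = x - 1/2"
  define A where "A = cmod (Gamma (Complex (1/2) \<tau>))"
  have l: "0 \<le> l" "l \<le> 1" using x by (auto simp: l_def)
  have A: "A \<ge> exp (- (pi * \<bar>\<tau>\<bar> / 2))" unfolding A_def by (rule cmod_Gamma_half_ge)
  then have A_pos: "A > 0" by (smt (verit) exp_gt_zero)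
  have half: "R (1/2) = A / sqrt pi"
    by (simp add: R_def A_def Gamma_one_half_real)
  have "Gamma (Complex (1/2) \<tau> + 1) = Complex (1/2) \<tau> * Gamma (Complex (1/2) \<tau>)"
    by (intro Gamma_plus1) (auto simp: complex_eq_iff elim!: nonpos_Ints_cases)
  moreover have "Complex (1/2) \<tau> + 1 = Complex (3/2) \<tau>" by (simp add: complex_eq_iff)
  ultimately have Gc: "Gamma (Complex (3/2) \<tau>) = Complex (1/2) \<tau> * Gamma (Complex (1/2) \<tau>)" by simp
  have half_notin: "(1/2 :: real) \<notin> \<int>\<^sub>\<le>\<^sub>0" by (auto elim!: nonpos_Ints_cases)
  have G32: "Gamma (3/2 :: real) = 1/2 * sqrt pi"
    using Gamma_plus1[of "1/2 :: real", OF half_notin] by (simp add: Gamma_one_half_real)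
  have three_half: "R (3/2) = 2 * cmod (Complex (1/2) \<tau>) * A / sqrt pi"
    unfolding R_def A_def Gc G32 by (simp add: norm_mult)
  have "\<bar>\<tau>\<bar> \<le> cmod (Complex (1/2) \<tau>)" using abs_Im_le_cmod[of "Complex (1/2) \<tau>"] by simp
  then have "\<bar>\<tau>\<bar> * A / sqrt pi \<le> R (3/2)"
    unfolding three_half using A_pos by (intro divide_right_mono mult_right_mono) auto
  then have "(A / sqrt pi) powr (1 - l) * (\<bar>\<tau>\<bar> * (A / sqrt pi)) powr l \<le> R (1/2) powr (1 - l) * R (3/2) powr l"
    unfolding half using l A_pos \<tau> by (intro mult_mono powr_mono2) auto
  also have "\<dots> \<le> R ((1 - l) * (1/2) + l * (3/2))"
    unfolding R_def using l by (intro cmod_Gamma_ratio_log_concave) auto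
  also have "(1 - l) * (1/2) + l * (3/2) = x" by (simp add: l_def field_simps)
  also have "(A / sqrt pi) powr (1 - l) * (\<bar>\<tau>\<bar> * (A / sqrt pi)) powr l
      = \<bar>\<tau>\<bar> powr l * ((A / sqrt pi) powr (1 - l) * (A / sqrt pi) powr l)"
    using A_pos by (subst powr_mult) (simp_all only: mult_ac)
  also have "\<dots> = \<bar>\<tau>\<bar> powr l * (A / sqrt pi)"
    using A_pos by (simp add: powr_add [symmetric])
  finally have *: "\<bar>\<tau>\<bar> powr l * (A / sqrt pi) \<le> R x" .
  \<comment> \<open>This accounts for the constant \<open>1/2\<close> in the claim: \<open>R (1/2)\<close> is \<open>A / sqrt pi\<close>.\<close>
  have "sqrt pi \<le> 2" using pi_less_4 by (intro real_le_lsqrt) auto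
  then have "1 / 2 \<le> 1 / sqrt pi" by (simp add: field_simps)
  then have "exp (- (pi * \<bar>\<tau>\<bar> / 2)) * (1 / 2) \<le> A * (1 / sqrt pi)"
    using A A_pos by (intro mult_mono) auto
  then have "\<bar>\<tau>\<bar> powr l * (exp (- (pi * \<bar>\<tau>\<bar> / 2)) / 2) \<le> \<bar>\<tau>\<bar> powr l * (A / sqrt pi)"
    by (intro mult_left_mono) auto
  from this * have "\<bar>\<tau>\<bar> powr l * (exp (- (pi * \<bar>\<tau>\<bar> / 2)) / 2) \<le> R x" by (rule order_trans)
  then have "Gamma x * (\<bar>\<tau>\<bar> powr l * (exp (- (pi * \<bar>\<tau>\<bar> / 2)) / 2)) \<le> Gamma x * R x"
    using x by (intro mult_left_mono) (auto intro!: less_imp_le Gamma_real_pos)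
  also have "Gamma x * R x = cmod (Gamma (Complex x \<tau>))"
  proof -
    have "Gamma x > 0" using x by (intro Gamma_real_pos) auto
    then show ?thesis by (simp add: R_def)
  qed
  finally show ?thesis by (simp add: l_def mult_ac)
qed

text \<open>The functional equation carries the bound from the strip \<open>1/2 \<le> Re s \<le> 3/2\<close> to the right,
  where each step divides by at least \<open>\<bar>\<tau>\<bar>\<close>, and by one step to the left into \<open>0 < Re s < 1/2\<close>,
  where the factor \<open>\<bar>a + i \<tau>\<bar>\<close> is at most \<open>2 \<bar>\<tau>\<bar>\<close>.\<close>
lemma norm_rGamma_vline_le:
  fixes a :: real
  assumes "a > 0"
  shows "\<exists>C. \<forall>\<tau>. \<bar>\<tau>\<bar> \<ge> 1 \<longrightarrow>
    cmod (rGamma (Complex a \<tau>)) \<le> C * (\<bar>\<tau>\<bar> powr (1/2 - a) * exp (pi * \<bar>\<tau>\<bar> / 2))"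
proof -
  have strip: "\<exists>C. \<forall>\<tau>. \<bar>\<tau>\<bar> \<ge> 1 \<longrightarrow>
    cmod (rGamma (Complex x \<tau>)) \<le> C * (\<bar>\<tau>\<bar> powr (1/2 - x) * exp (pi * \<bar>\<tau>\<bar> / 2))"
    if x: "1/2 \<le> x" "x \<le> 3/2" for x
  proof (intro exI[of _ "2 / Gamma x"] allI impI)
    fix \<tau> :: real assume \<tau>: "\<bar>\<tau>\<bar> \<ge> 1"
    define w where "w = \<bar>\<tau>\<bar> powr (x - 1/2) * exp (- (pi * \<bar>\<tau>\<bar> / 2))"
    have w: "w > 0" using \<tau> by (auto simp: w_def)
    have G: "Gamma x > 0" using x by (intro Gamma_real_pos) auto
    have "cmod (rGamma (Complex x \<tau>)) = inverse (cmod (Gamma (Complex x \<tau>)))"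
      by (simp add: rGamma_inverse_Gamma norm_inverse)
    also have "\<dots> \<le> inverse (Gamma x / 2 * w)"
      using cmod_Gamma_strip_ge[OF x \<tau>] w G by (intro le_imp_inverse_le) (auto simp: w_def)
    also have "\<dots> = 2 / Gamma x * inverse w" using w G by (simp add: field_simps)
    also have "inverse w = \<bar>\<tau>\<bar> powr (1/2 - x) * exp (pi * \<bar>\<tau>\<bar> / 2)"
      by (simp add: w_def exp_minus powr_minus [symmetric] algebra_simps)
    finally show "cmod (rGamma (Complex x \<tau>)) \<le> 2 / Gamma x * (\<bar>\<tau>\<bar> powr (1/2 - x) * exp (pi * \<bar>\<tau>\<bar> / 2))" .
  qed
  have up: "\<exists>C. \<forall>\<tau>. \<bar>\<tau>\<bar> \<ge> 1 \<longrightarrow>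
    cmod (rGamma (Complex (x + real n) \<tau>)) \<le> C * (\<bar>\<tau>\<bar> powr (1/2 - (x + real n)) * exp (pi * \<bar>\<tau>\<bar> / 2))"
    if x: "1/2 \<le> x" "x \<le> 3/2" for x n
  proof (induction n)
    case 0
    then show ?case using strip[OF x] by simp
  next
    case (Suc n)
    then obtain C where C: "\<And>\<tau>. \<bar>\<tau>\<bar> \<ge> 1 \<Longrightarrow>
      cmod (rGamma (Complex (x + real n) \<tau>)) \<le> C * (\<bar>\<tau>\<bar> powr (1/2 - (x + real n)) * exp (pi * \<bar>\<tau>\<bar> / 2))"
      by blast
    show ?case
    proof (intro exI[of _ C] allI impI)
      fix \<tau> :: real assume \<tau>: "\<bar>\<tau>\<bar> \<ge> 1"
      let ?z = "Complex (x + real n) \<tau>"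
      have "Complex (x + real (Suc n)) \<tau> = ?z + 1" by (simp add: complex_eq_iff)
      then have "rGamma ?z = ?z * rGamma (Complex (x + real (Suc n)) \<tau>)" by (simp only: rGamma_plus1)
      then have "cmod (rGamma ?z) = cmod ?z * cmod (rGamma (Complex (x + real (Suc n)) \<tau>))"
        by (simp only: norm_mult)
      moreover have "\<bar>\<tau>\<bar> \<le> cmod ?z" using abs_Im_le_cmod[of ?z] by simp
      ultimately have "\<bar>\<tau>\<bar> * cmod (rGamma (Complex (x + real (Suc n)) \<tau>)) \<le> cmod (rGamma ?z)"
        by (simp only: mult_right_mono norm_ge_zero)
      also note C[OF \<tau>]
      finally have "cmod (rGamma (Complex (x + real (Suc n)) \<tau>))
          \<le> C * (\<bar>\<tau>\<bar> powr (1/2 - (x + real n)) * exp (pi * \<bar>\<tau>\<bar> / 2)) / \<bar>\<tau>\<bar>"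
        using \<tau> by (subst pos_le_divide_eq) (auto simp: mult.commute)
      also have "\<dots> = C * (\<bar>\<tau>\<bar> powr (1/2 - (x + real n)) / \<bar>\<tau>\<bar> * exp (pi * \<bar>\<tau>\<bar> / 2))"
        by (simp only: times_divide_eq_left times_divide_eq_right)
      also have "\<bar>\<tau>\<bar> powr (1/2 - (x + real n)) / \<bar>\<tau>\<bar> = \<bar>\<tau>\<bar> powr (1/2 - (x + real (Suc n)))"
        using \<tau> powr_diff[of "\<bar>\<tau>\<bar>" "1/2 - (x + real n)" 1] by (simp add: algebra_simps)
      finally show "cmod (rGamma (Complex (x + real (Suc n)) \<tau>))
          \<le> C * (\<bar>\<tau>\<bar> powr (1/2 - (x + real (Suc n))) * exp (pi * \<bar>\<tau>\<bar> / 2))" .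
    qed
  qed
  show ?thesis
  proof (cases "a \<ge> 1/2")
    case True
    define n where "n = nat \<lfloor>a - 1/2\<rfloor>"
    have "real n \<le> a - 1/2" "a - 1/2 < real n + 1" using True by (auto simp: n_def)
    then show ?thesis using up[of "a - real n" n] by auto
  next
    case False
    then obtain C where C: "\<And>\<tau>. \<bar>\<tau>\<bar> \<ge> 1 \<Longrightarrow>
      cmod (rGamma (Complex (a + 1) \<tau>)) \<le> C * (\<bar>\<tau>\<bar> powr (1/2 - (a + 1)) * exp (pi * \<bar>\<tau>\<bar> / 2))"
      using strip[of "a + 1"] assms by auto
    show ?thesis
    proof (intro exI[of _ "2 * C"] allI impI)
      fix \<tau> :: real assume \<tau>: "\<bar>\<tau>\<bar> \<ge> 1"
      have "Complex (a + 1) \<tau> = Complex a \<tau> + 1" by (simp add: complex_eq_iff)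
      then have "rGamma (Complex a \<tau>) = Complex a \<tau> * rGamma (Complex (a + 1) \<tau>)"
        by (simp only: rGamma_plus1)
      then have "cmod (rGamma (Complex a \<tau>)) = cmod (Complex a \<tau>) * cmod (rGamma (Complex (a + 1) \<tau>))"
        by (simp only: norm_mult)
      also have "\<dots> \<le> (2 * \<bar>\<tau>\<bar>) * (C * (\<bar>\<tau>\<bar> powr (1/2 - (a + 1)) * exp (pi * \<bar>\<tau>\<bar> / 2)))"
      proof (rule mult_mono[OF _ C[OF \<tau>]])
        have "cmod (Complex a \<tau>) \<le> \<bar>a\<bar> + \<bar>\<tau>\<bar>" using cmod_le[of "Complex a \<tau>"] by simp
        then show "cmod (Complex a \<tau>) \<le> 2 * \<bar>\<tau>\<bar>" using False assms \<tau> by simp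
      qed auto
      also have "\<dots> = 2 * C * ((\<bar>\<tau>\<bar> * \<bar>\<tau>\<bar> powr (1/2 - (a + 1))) * exp (pi * \<bar>\<tau>\<bar> / 2))"
        by (simp only: mult_ac)
      also have "\<bar>\<tau>\<bar> * \<bar>\<tau>\<bar> powr (1/2 - (a + 1)) = \<bar>\<tau>\<bar> powr (1/2 - a)"
        using \<tau> powr_add[of "\<bar>\<tau>\<bar>" 1 "1/2 - (a + 1)"] by simp
      finally show "cmod (rGamma (Complex a \<tau>)) \<le> 2 * C * (\<bar>\<tau>\<bar> powr (1/2 - a) * exp (pi * \<bar>\<tau>\<bar> / 2))" .
    qed
  qed
qed

section \<open>Laplace transform of the inversion kernel\<close>

lemma powr_of_real_eq_exp: "t > 0 \<Longrightarrow> complex_of_real t powr w = exp (w * complex_of_real (ln t))"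
  by (simp add: powr_def Ln_of_real)

text \<open>Euler's integral for \<open>\<Gamma>(s)\<close>, rescaled by \<open>t \<mapsto> p t\<close>.\<close>
lemma laplace_powr:
  fixes s :: complex and p :: real
  assumes s: "Re s > 0" and p: "p > 0"
  shows "set_integrable lborel {0<..} (\<lambda>t. complex_of_real (exp (- (p * t))) * complex_of_real t powr (s - 1))"
    and "(LINT t:{0<..}|lborel. complex_of_real (exp (- (p * t))) * complex_of_real t powr (s - 1))
           = Gamma s * complex_of_real p powr (- s)"
proof -
  let ?f = "\<lambda>t. complex_of_real t powr (s - 1) / of_real (exp t)"
  let ?g = "\<lambda>t. indicator {0<..} t *\<^sub>R ?f t"
  have meas: "?g \<in> borel_measurable borel"
    by (intro borel_measurable_continuous_on_indicator continuous_intros) auto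
  have "?f absolutely_integrable_on {0<..}"
    using absolutely_integrable_Gamma_integral[OF s, of 1] by simp
  then have int_g: "integrable lborel ?g"
    unfolding set_integrable_def using meas by (subst (asm) integrable_completion) auto
  then have "set_integrable lborel {0<..} ?f" by (simp add: set_integrable_def)
  from set_borel_integral_eq_integral(2)[OF this] have val: "integral\<^sup>L lborel ?g = Gamma s"
    using integral_unique[OF Gamma_integral_complex'[OF s]] by (simp add: set_lebesgue_integral_def)
  have scale: "?g (0 + p * t) = complex_of_real p powr (s - 1) * (indicator {0<..} t *\<^sub>R
      (complex_of_real (exp (- (p * t))) * complex_of_real t powr (s - 1)))" for t
  proof (cases "t > 0")
    case True
    have "complex_of_real (p * t) powr (s - 1) = complex_of_real p powr (s - 1) * complex_of_real t powr (s - 1)"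
      using p True by (simp only: powr_of_real_eq_exp mult_pos_pos ln_mult_pos of_real_add distrib_left exp_add)
    then show ?thesis using p True by (simp add: exp_minus divide_inverse mult_ac)
  next
    case False
    then show ?thesis using p by (simp add: zero_less_mult_iff)
  qed
  have nz: "complex_of_real p powr (s - 1) \<noteq> 0" using p by simp
  have "integrable lborel (\<lambda>t. ?g (0 + p * t))"
    using p by (intro lborel_integrable_real_affine int_g) simp
  then have "set_integrable lborel {0<..} (\<lambda>t. complex_of_real p powr (s - 1)
      * (complex_of_real (exp (- (p * t))) * complex_of_real t powr (s - 1)))"
    unfolding scale set_integrable_def by (simp only: mult_scaleR_right)
  then show "set_integrable lborel {0<..} (\<lambda>t. complex_of_real (exp (- (p * t))) * complex_of_real t powr (s - 1))"
    by (simp only: set_integrable_mult_right_iff[OF nz])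
  have "Gamma s = \<bar>p\<bar> *\<^sub>R (LINT t|lborel. ?g (0 + p * t))"
    unfolding val [symmetric] using p by (intro lborel_integral_real_affine) simp
  also have "(LINT t|lborel. ?g (0 + p * t)) = complex_of_real p powr (s - 1) *
      (LINT t:{0<..}|lborel. complex_of_real (exp (- (p * t))) * complex_of_real t powr (s - 1))"
    unfolding scale set_lebesgue_integral_def by (rule integral_mult_right_zero)
  finally have "Gamma s = (complex_of_real p * complex_of_real p powr (s - 1)) *
      (LINT t:{0<..}|lborel. complex_of_real (exp (- (p * t))) * complex_of_real t powr (s - 1))"
    using p by (simp add: scaleR_conv_of_real mult_ac)
  also have "complex_of_real p * complex_of_real p powr (s - 1) = complex_of_real p powr s"
    using p powr_add[of "complex_of_real p" 1 "s - 1"] by simp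
  finally show "(LINT t:{0<..}|lborel. complex_of_real (exp (- (p * t))) * complex_of_real t powr (s - 1))
           = Gamma s * complex_of_real p powr (- s)"
    using p by (simp add: powr_minus field_simps)
qed

lemma laplace_powr_real:
  fixes a p :: real
  assumes a: "a > 0" and p: "p > 0"
  shows "set_integrable lborel {0<..} (\<lambda>t. exp (- (p * t)) * t powr (a - 1))"
    and "(LINT t:{0<..}|lborel. exp (- (p * t)) * t powr (a - 1)) = Gamma a * p powr (- a)"
proof -
  have *: "indicator {0<..} t *\<^sub>R (complex_of_real (exp (- (p * t))) * complex_of_real t powr (complex_of_real a - 1))
     = complex_of_real (indicator {0<..} t *\<^sub>R (exp (- (p * t)) * t powr (a - 1)))" for t
    by (cases "t > 0") (simp_all add: powr_of_real [symmetric])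
  note L = laplace_powr[of "complex_of_real a" p]
  show "set_integrable lborel {0<..} (\<lambda>t. exp (- (p * t)) * t powr (a - 1))"
    using L(1) a p unfolding set_integrable_def * complex_of_real_integrable_eq by simp
  have "complex_of_real (LINT t:{0<..}|lborel. exp (- (p * t)) * t powr (a - 1))
      = complex_of_real (Gamma a * p powr (- a))"
    using L(2) a p unfolding set_lebesgue_integral_def * integral_complex_of_real
    by (simp add: Gamma_complex_of_real powr_of_real [symmetric])
  then show "(LINT t:{0<..}|lborel. exp (- (p * t)) * t powr (a - 1)) = Gamma a * p powr (- a)"
    by (simp only: of_real_eq_iff)
qed

text \<open>The inversion kernel \<open>t\<^bsup>-(1+z)/2\<^esup> I\<^bsub>-(1+z)\<^esub>(2 \<surd>t)\<close>, see \<open>inv_kernel_eq_bessel\<close>, with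
  the power of \<open>t\<close> split off and written through \<open>ln t\<close>. What remains is an entire power series
  in \<open>t\<close>, so continuity in \<open>t\<close> and joint measurability in \<open>(z, t)\<close> can be read off.\<close>
definition inv_kernel :: "complex \<Rightarrow> real \<Rightarrow> complex" where
  "inv_kernel z t = exp (- (1 + z) * of_real (ln t)) * (\<Sum>n. rGamma (of_nat n - z) / fact n * of_real t ^ n)"

text \<open>Since \<open>1/\<Gamma>(w) = w (w + 1) \<dots> (w + n - 1) / \<Gamma>(w + n)\<close> and each factor has modulus at least its
  real part, passing from \<open>w\<close> to \<open>w + n\<close> shrinks \<open>1/\<bar>\<Gamma>\<bar>\<close> at least as much as it does for the
  real argument \<open>Re w\<close>.\<close>
lemma norm_rGamma_shift_le:
  fixes w :: complex
  assumes "Re w > 0"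
  shows "norm (rGamma (of_nat n + w)) \<le> norm (rGamma w) * Gamma (Re w) * rGamma (real n + Re w)"
proof -
  have "pochhammer (Re w) n \<le> norm (pochhammer w n)"
    unfolding pochhammer_prod prod_norm [symmetric]
  proof (rule prod_mono)
    fix k show "0 \<le> Re w + of_nat k \<and> Re w + of_nat k \<le> cmod (w + of_nat k)"
      using assms complex_Re_le_cmod[of "w + of_nat k"] by simp
  qed
  moreover have "norm (rGamma w) = norm (pochhammer w n) * norm (rGamma (of_nat n + w))"
    using pochhammer_rGamma[of w n] by (simp add: norm_mult add.commute)
  ultimately have 1: "pochhammer (Re w) n * norm (rGamma (of_nat n + w)) \<le> norm (rGamma w)"
    by (simp add: mult_right_mono)
  have "Gamma (Re w) > 0" using assms by (rule Gamma_real_pos)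
  moreover have "rGamma (Re w) = pochhammer (Re w) n * rGamma (real n + Re w)"
    using pochhammer_rGamma[of "Re w" n] by (simp add: add.commute)
  moreover have "rGamma (Re w) * Gamma (Re w) = 1"
    using calculation(1) by (simp add: rGamma_inverse_Gamma)
  ultimately have 2: "pochhammer (Re w) n * (Gamma (Re w) * rGamma (real n + Re w)) = 1"
    by (simp add: mult_ac)
  have "pochhammer (Re w) n > 0" using assms by (rule pochhammer_pos)
  with 1 have "norm (rGamma (of_nat n + w)) \<le> norm (rGamma w) / pochhammer (Re w) n"
    by (simp add: field_simps)
  also have "\<dots> = norm (rGamma w) * (Gamma (Re w) * rGamma (real n + Re w))"
    using 2 \<open>pochhammer (Re w) n > 0\<close> by (simp add: field_simps)
  finally show ?thesis by (simp add: mult_ac)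
qed

lemma rGamma_real_nonneg: "a > 0 \<Longrightarrow> rGamma (a::real) \<ge> 0"
  using Gamma_real_pos[of a] by (simp add: rGamma_inverse_Gamma less_imp_le)

lemma rGamma_shift_bounded:
  fixes a :: real
  assumes "a > 0"
  shows "rGamma (real n + a) \<le> rGamma a * (1 + 1 / a)"
proof (cases n)
  case 0
  then show ?thesis using assms rGamma_real_nonneg[OF assms] by (simp add: algebra_simps)
next
  case (Suc m)
  have "1 \<le> pochhammer (a + 1) m"
    unfolding pochhammer_prod using assms by (intro prod_ge_1) auto
  then have "a \<le> pochhammer a n" using assms by (simp add: Suc pochhammer_rec)
  then have "a * rGamma (real n + a) \<le> pochhammer a n * rGamma (real n + a)"
    using assms by (intro mult_right_mono rGamma_real_nonneg) auto
  also have "\<dots> = rGamma a" using pochhammer_rGamma[of a n] by (simp add: add.commute)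
  finally have "rGamma (real n + a) \<le> rGamma a * (1 / a)" using assms by (simp add: field_simps)
  also have "\<dots> \<le> rGamma a * (1 + 1 / a)" using rGamma_real_nonneg[OF assms] by (intro mult_left_mono) auto
  finally show ?thesis .
qed

lemma summable_real_kernel:
  fixes a t :: real
  assumes "a > 0"
  shows "summable (\<lambda>n. rGamma (real n + a) / fact n * \<bar>t\<bar> ^ n)"
proof (rule summable_comparison_test')
  show "summable (\<lambda>n. rGamma a * (1 + 1 / a) * (inverse (fact n) * \<bar>t\<bar> ^ n))"
    by (intro summable_mult summable_exp)
  fix n :: nat assume "n \<ge> 0"
  have "\<bar>rGamma (real n + a)\<bar> * (inverse (fact n) * \<bar>t\<bar> ^ n)
      \<le> rGamma a * (1 + 1 / a) * (inverse (fact n) * \<bar>t\<bar> ^ n)"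
    using rGamma_shift_bounded[OF assms, of n] rGamma_real_nonneg[of "real n + a"] assms
    by (intro mult_right_mono) auto
  then show "norm (rGamma (real n + a) / fact n * \<bar>t\<bar> ^ n)
      \<le> rGamma a * (1 + 1 / a) * (inverse (fact n) * \<bar>t\<bar> ^ n)"
    by (simp add: abs_mult divide_inverse mult_ac)
qed

lemma norm_kernel_coeff_le:
  assumes "Re z < 0"
  shows "norm (rGamma (of_nat n - z) / fact n * complex_of_real t ^ n)
    \<le> norm (rGamma (- z)) * Gamma (- Re z) * (rGamma (real n + (- Re z)) / fact n * \<bar>t\<bar> ^ n)"
proof -
  have "norm (rGamma (of_nat n - z) / fact n * complex_of_real t ^ n)
      = norm (rGamma (of_nat n + (- z))) * (\<bar>t\<bar> ^ n / fact n)"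
    by (simp add: norm_mult norm_divide norm_power)
  also have "\<dots> \<le> (norm (rGamma (- z)) * Gamma (Re (- z)) * rGamma (real n + Re (- z))) * (\<bar>t\<bar> ^ n / fact n)"
    using assms by (intro mult_right_mono norm_rGamma_shift_le) auto
  finally show ?thesis by (simp add: mult_ac)
qed

lemma summable_norm_kernel:
  assumes "Re z < 0"
  shows "summable (\<lambda>n. norm (rGamma (of_nat n - z) / fact n * complex_of_real t ^ n))"
proof (rule summable_comparison_test')
  show "summable (\<lambda>n. norm (rGamma (- z)) * Gamma (- Re z) * (rGamma (real n + (- Re z)) / fact n * \<bar>t\<bar> ^ n))"
    using assms by (intro summable_mult summable_real_kernel) auto
qed (use norm_kernel_coeff_le[OF assms] in simp)

lemma inv_kernel_eq_bessel:
  assumes "Re z < 0" "t > 0"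
  shows "bessel_I (- (1 + z)) (2 * sqrt t) * complex_of_real t powr (- (1 + z) / 2) = inv_kernel z t"
proof -
  define E where "E = exp (- (1 + z) / 2 * of_real (ln t))"
  have "complex_of_real (2 * sqrt t / 2) powr (2 * of_nat n + (- (1 + z))) * rGamma (of_nat n + (- (1 + z)) + 1) / fact n
      = E * (rGamma (of_nat n - z) / fact n * complex_of_real t ^ n)" for n
  proof -
    have "complex_of_real (sqrt t) powr (2 * of_nat n + (- (1 + z)))
        = exp ((2 * of_nat n + (- (1 + z))) * complex_of_real (ln t / 2))"
      using assms by (simp add: powr_of_real_eq_exp ln_sqrt)
    also have "(2 * of_nat n + (- (1 + z))) * complex_of_real (ln t / 2)
        = of_nat n * complex_of_real (ln t) + - (1 + z) / 2 * of_real (ln t)"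
      by (simp add: field_simps)
    also have "exp \<dots> = exp (complex_of_real (ln t)) ^ n * E"
      by (simp add: exp_add exp_of_nat_mult E_def)
    also have "exp (complex_of_real (ln t)) = complex_of_real t"
      using assms by (simp add: exp_of_real)
    finally show ?thesis by (simp add: algebra_simps)
  qed
  then have "bessel_I (- (1 + z)) (2 * sqrt t) = E * (\<Sum>n. rGamma (of_nat n - z) / fact n * complex_of_real t ^ n)"
    unfolding bessel_I_def
    by (simp only: suminf_mult[OF summable_norm_cancel[OF summable_norm_kernel[OF assms(1)]]])
  moreover have "complex_of_real t powr (- (1 + z) / 2) = E"
    using assms by (simp add: powr_of_real_eq_exp E_def)
  moreover have "E * E = exp (- (1 + z) * of_real (ln t))"
  proof -
    have "- (1 + z) / 2 * of_real (ln t) + - (1 + z) / 2 * of_real (ln t) = - (1 + z) * complex_of_real (ln t)"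
      by (simp add: field_simps)
    then show ?thesis by (simp only: E_def exp_add [symmetric])
  qed
  ultimately show ?thesis unfolding inv_kernel_def by (simp add: mult_ac)
qed

text \<open>The imaginary part of the order enters only through \<open>1/\<bar>\<Gamma>(- z)\<bar>\<close>. This separates the variables:
  on a vertical line the factor depending on \<open>t\<close> is fixed.\<close>
lemma norm_inv_kernel_le:
  assumes z: "Re z < 0" and t: "t > 0"
  shows "norm (inv_kernel z t) \<le> norm (rGamma (- z)) * (Gamma (- Re z) * norm (inv_kernel (of_real (Re z)) t))"
proof -
  define a where "a = - Re z"
  have a: "a > 0" using z by (simp add: a_def)
  define W where "W = norm (rGamma (- z)) * Gamma a"
  define s where "s = (\<Sum>n. rGamma (real n + a) / fact n * t ^ n)"
  have summ: "summable (\<lambda>n. rGamma (real n + a) / fact n * t ^ n)"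
    using summable_real_kernel[OF a, of t] t by simp
  have s: "s \<ge> 0" unfolding s_def using a t
    by (intro suminf_nonneg summ) (auto intro!: mult_nonneg_nonneg divide_nonneg_nonneg rGamma_real_nonneg)
  have "rGamma (of_nat n - complex_of_real (Re z)) = complex_of_real (rGamma (real n + a))" for n
    using rGamma_complex_of_real[of "real n + a"] by (simp add: a_def)
  then have "rGamma (of_nat n - complex_of_real (Re z)) / fact n * complex_of_real t ^ n
      = complex_of_real (rGamma (real n + a) / fact n * t ^ n)" for n
    by simp
  then have eq: "(\<Sum>n. rGamma (of_nat n - complex_of_real (Re z)) / fact n * complex_of_real t ^ n) = complex_of_real s"
    unfolding s_def by (simp only: suminf_of_real [OF summ])
  have "norm (\<Sum>n. rGamma (of_nat n - z) / fact n * complex_of_real t ^ n)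
     \<le> (\<Sum>n. norm (rGamma (of_nat n - z) / fact n * complex_of_real t ^ n))"
    by (rule summable_norm[OF summable_norm_kernel[OF z]])
  also have "\<dots> \<le> (\<Sum>n. W * (rGamma (real n + a) / fact n * t ^ n))"
    using norm_kernel_coeff_le[OF z, of _ t] t
    by (intro suminf_le summable_norm_kernel z summable_mult summ) (simp add: W_def a_def)
  also have "\<dots> = W * s" unfolding s_def by (rule suminf_mult[OF summ])
  finally have "norm (inv_kernel z t) \<le> norm (exp (- (1 + z) * of_real (ln t))) * (W * s)"
    unfolding inv_kernel_def norm_mult by (intro mult_left_mono) auto
  also have "norm (exp (- (1 + z) * of_real (ln t))) = norm (exp (- (1 + of_real (Re z)) * complex_of_real (ln t)))"
    by simp
  also have "\<dots> * (W * s) = W * norm (inv_kernel (of_real (Re z)) t)"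
    unfolding inv_kernel_def eq norm_mult using s by simp
  finally show ?thesis by (simp add: W_def a_def mult_ac)
qed

lemma continuous_on_inv_kernel:
  assumes "Re z < 0"
  shows "continuous_on {0<..} (inv_kernel z)"
proof -
  have "isCont (\<lambda>w. \<Sum>n. rGamma (of_nat n - z) / fact n * w ^ n) w" for w :: complex
    using summable_norm_cancel[OF summable_norm_kernel[OF assms, of "norm w + 1"]]
    by (rule isCont_powser) (simp add: add_nonneg_pos)
  then have "continuous_on UNIV (\<lambda>w::complex. \<Sum>n. rGamma (of_nat n - z) / fact n * w ^ n)"
    by (simp add: continuous_at_imp_continuous_on)
  from continuous_on_compose2[OF this, of "{0<..}" complex_of_real]
  have "continuous_on {0<..} (\<lambda>t. \<Sum>n. rGamma (of_nat n - z) / fact n * complex_of_real t ^ n)"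
    by (simp add: continuous_on_of_real)
  then show ?thesis unfolding inv_kernel_def by (intro continuous_intros) auto
qed

lemma measurable_inv_kernel:
  "(\<lambda>(\<tau>, t). inv_kernel (Complex \<gamma> \<tau>) t) \<in> borel_measurable (lborel \<Otimes>\<^sub>M lborel)"
proof -
  have [measurable]: "(\<lambda>\<tau>. rGamma (of_nat n - Complex \<gamma> \<tau>)) \<in> borel_measurable borel" for n
    by (intro borel_measurable_continuous_onI continuous_on_compose2[OF continuous_on_rGamma[of UNIV]])
       (auto simp: Complex_eq intro!: continuous_intros)
  have [measurable]: "Complex \<gamma> \<in> borel_measurable borel"
    by (intro borel_measurable_continuous_onI) (simp add: Complex_eq [abs_def] continuous_intros)
  show ?thesis unfolding inv_kernel_def by measurable
qed

text \<open>Term by term: the \<open>n\<close>-th term is a multiple of \<open>t\<^bsup>n-1-z\<^esup>\<close>, whose Laplace transform contributes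
  \<open>\<Gamma>(n - z)\<close>, cancelling the reciprocal Gamma factor and leaving \<open>p\<^bsup>z-n\<^esup> / n!\<close>. The condition
  \<open>Re z < 0\<close> makes the term \<open>n = 0\<close> integrable at the origin.\<close>
theorem laplace_inv_kernel:
  assumes z: "Re z < 0" and p: "p > 0"
  shows "set_integrable lborel {0<..} (\<lambda>t. complex_of_real (exp (- (p * t))) * inv_kernel z t)"
    and "(LINT t:{0<..}|lborel. complex_of_real (exp (- (p * t))) * inv_kernel z t)
          = exp (1 / of_real p) * of_real p powr z"
proof -
  define a where "a = - Re z"
  have a: "a > 0" using z by (simp add: a_def)
  define c where "c n = rGamma (of_nat n - z) / fact n" for n
  define f where "f n t = c n * (indicator {0<..} t *\<^sub>R
      (complex_of_real (exp (- (p * t))) * complex_of_real t powr ((of_nat n - z) - 1)))" for n t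
  have Re_pos: "Re (of_nat n - z) > 0" for n using z by simp
  note L = laplace_powr[OF Re_pos p]
  have int_f: "integrable lborel (f n)" for n
    unfolding f_def using L(1)[of n] by (intro integrable_mult_right) (simp add: set_integrable_def)
  have f_pos: "f n t = complex_of_real (exp (- (p * t))) * exp (- (1 + z) * of_real (ln t)) * (c n * complex_of_real t ^ n)"
    if t: "t > 0" for n t
  proof -
    have "complex_of_real t powr ((of_nat n - z) - 1) = exp (of_nat n * complex_of_real (ln t) + - (1 + z) * of_real (ln t))"
      using t by (simp add: powr_of_real_eq_exp algebra_simps)
    also have "\<dots> = exp (complex_of_real (ln t)) ^ n * exp (- (1 + z) * of_real (ln t))"
      by (simp only: exp_add exp_of_nat_mult)
    also have "exp (complex_of_real (ln t)) = complex_of_real t" using t by (simp add: exp_of_real)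
    finally show ?thesis using t by (simp add: f_def mult_ac)
  qed
  have f_neg: "f n t = 0" if "t \<le> 0" for n t using that by (simp add: f_def)
  have summ_f: "summable (\<lambda>n. norm (f n t))" for t
  proof (cases "t > 0")
    case True
    then show ?thesis
      by (simp only: f_pos norm_mult[of "_ * exp _"]) (use summable_norm_kernel[OF z, of t] in \<open>auto simp: c_def intro!: summable_mult\<close>)
  qed (simp add: f_neg)
  have suminf_f: "(\<Sum>n. f n t) = indicator {0<..} t *\<^sub>R (complex_of_real (exp (- (p * t))) * inv_kernel z t)" for t
  proof (cases "t > 0")
    case True
    have "(\<Sum>n. f n t) = complex_of_real (exp (- (p * t))) * exp (- (1 + z) * of_real (ln t)) * (\<Sum>n. c n * complex_of_real t ^ n)"
      unfolding f_pos[OF True] c_def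
      by (rule suminf_mult[OF summable_norm_cancel[OF summable_norm_kernel[OF z]]])
    then show ?thesis using True by (simp add: inv_kernel_def c_def mult_ac)
  qed (simp add: f_neg)
  have norm_f: "(LINT t|lborel. norm (f n t)) \<le> p powr (- a) * norm (rGamma (- z)) * Gamma a * (inverse (fact n) * (1 / p) ^ n)" for n
  proof -
    have "norm (f n t) = norm (c n) * (indicator {0<..} t *\<^sub>R (exp (- (p * t)) * t powr ((real n + a) - 1)))" for t
      by (cases "t > 0") (simp_all add: f_def norm_mult powr_of_real_eq_exp powr_def a_def mult_ac)
    then have "(LINT t|lborel. norm (f n t)) = norm (c n) * (LINT t:{0<..}|lborel. exp (- (p * t)) * t powr ((real n + a) - 1))"
      by (simp add: set_lebesgue_integral_def)
    also have "\<dots> = norm (rGamma (of_nat n + (- z))) * Gamma (real n + a) * (p powr (- (real n + a)) / fact n)"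
      using laplace_powr_real(2)[of "real n + a" p] a p by (simp add: c_def norm_divide)
    also have "\<dots> \<le> (norm (rGamma (- z)) * Gamma (Re (- z)) * rGamma (real n + Re (- z))) * Gamma (real n + a) * (p powr (- (real n + a)) / fact n)"
      using z a p by (intro mult_right_mono norm_rGamma_shift_le) (auto intro!: less_imp_le Gamma_real_pos)
    also have "\<dots> = norm (rGamma (- z)) * Gamma a * (p powr (- (real n + a)) / fact n)"
    proof -
      have na: "real n + a > 0" using a by simp
      have "rGamma (real n + a) * Gamma (real n + a) = 1"
        using Gamma_real_pos[OF na] by (simp add: rGamma_inverse_Gamma)
      then show ?thesis by (simp add: a_def mult_ac)
    qed
    also have "p powr (- (real n + a)) = p powr (- a) * (1 / p) ^ n"
      using p by (simp add: powr_diff powr_realpow power_one_over field_simps powr_minus powr_add)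
    finally show ?thesis by (simp add: divide_inverse mult_ac)
  qed
  have summ: "summable (\<lambda>n. LINT t|lborel. norm (f n t))"
  proof (rule summable_comparison_test')
    show "summable (\<lambda>n. p powr (- a) * norm (rGamma (- z)) * Gamma a * (inverse (fact n) * (1 / p) ^ n))"
      by (intro summable_mult summable_exp)
    show "norm (LINT t|lborel. norm (f n t)) \<le> p powr (- a) * norm (rGamma (- z)) * Gamma a * (inverse (fact n) * (1 / p) ^ n)"
      if "n \<ge> 0" for n
      using norm_f[of n] Bochner_Integration.integral_nonneg[of lborel "\<lambda>t. norm (f n t)"] by simp
  qed
  show "set_integrable lborel {0<..} (\<lambda>t. complex_of_real (exp (- (p * t))) * inv_kernel z t)"
    unfolding set_integrable_def suminf_f [symmetric]
    by (rule integrable_suminf[OF int_f _ summ]) (use summ_f in auto)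
  have "(LINT t|lborel. f n t) = of_real p powr z * ((1 / of_real p) ^ n /\<^sub>R fact n)" for n
  proof -
    have "(LINT t|lborel. f n t) = c n * (Gamma (of_nat n - z) * of_real p powr (- (of_nat n - z)))"
      unfolding f_def L(2)[of n, symmetric] set_lebesgue_integral_def by (rule integral_mult_right_zero)
    moreover have "rGamma (of_nat n - z) * Gamma (of_nat n - z) = 1"
    proof -
      have "of_nat n - z \<notin> \<int>\<^sub>\<le>\<^sub>0"
      proof
        assume "of_nat n - z \<in> \<int>\<^sub>\<le>\<^sub>0"
        then obtain k where "of_nat n - z = of_int k" "k \<le> 0" by (elim nonpos_Ints_cases)
        then show False using Re_pos[of n] by simp
      qed
      then show ?thesis by (simp add: rGamma_inverse_Gamma Gamma_eq_zero_iff)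
    qed
    moreover have "complex_of_real p powr (- (of_nat n - z)) = of_real p powr z * (1 / of_real p) ^ n"
      using p by (simp add: powr_diff powr_nat field_simps)
    moreover have "c n * (Gamma (of_nat n - z) * (of_real p powr z * (1 / of_real p) ^ n))
        = (rGamma (of_nat n - z) * Gamma (of_nat n - z)) * (of_real p powr z * ((1 / of_real p) ^ n / fact n))"
      by (simp add: c_def divide_inverse mult_ac)
    ultimately have "(LINT t|lborel. f n t) = of_real p powr z * ((1 / of_real p) ^ n / fact n)"
      by (simp only: mult_1)
    then show ?thesis by (simp add: scaleR_conv_of_real divide_inverse mult_ac)
  qed
  moreover have "(\<lambda>n. LINT t|lborel. f n t) sums (LINT t|lborel. (\<Sum>n. f n t))"
    by (rule sums_integral[OF int_f _ summ]) (use summ_f in auto)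
  moreover have "(\<lambda>n. of_real p powr z * ((1 / of_real p) ^ n /\<^sub>R fact n)) sums (of_real p powr z * exp (1 / complex_of_real p))"
    by (intro sums_mult exp_converges)
  ultimately have "(LINT t|lborel. (\<Sum>n. f n t)) = of_real p powr z * exp (1 / complex_of_real p)"
    by (simp add: sums_unique2)
  then show "(LINT t:{0<..}|lborel. complex_of_real (exp (- (p * t))) * inv_kernel z t)
          = exp (1 / of_real p) * of_real p powr z"
    by (simp add: suminf_f set_lebesgue_integral_def mult_ac)
qed

section \<open>The Macdonald function as a bilateral exponential integral\<close>

lemma integrable_exp_neg_abs:
  fixes d :: real
  assumes "d > 0"
  shows "integrable lborel (\<lambda>v. exp (- d * \<bar>v\<bar>))"
proof -
  define h where "h = (\<lambda>v::real. indicator {0<..} v *\<^sub>R exp (- (d * v)))"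
  have "indicator {0<..} t *\<^sub>R (exp (- (d * t)) * t powr (1 - 1)) = h t" for t
    by (auto simp: h_def indicator_def)
  then have h: "integrable lborel h"
    using laplace_powr_real(1)[of 1 d] assms by (simp add: set_integrable_def)
  have h': "integrable lborel (\<lambda>v. h (0 + (- 1) * v))"
    by (rule lborel_integrable_real_affine[OF h]) simp
  have "integrable lborel (\<lambda>v. h v + h (0 + (- 1) * v) + indicator {0} v)"
    by (intro Bochner_Integration.integrable_add h h') (simp add: integrable_indicator_iff)
  moreover have "h v + h (0 + (- 1) * v) + indicator {0} v = exp (- d * \<bar>v\<bar>)" for v
    by (auto simp: h_def indicator_def)
  ultimately show ?thesis by simp
qed

lemma exp_neg_le_power:
  fixes y :: real
  assumes "y > 0"
  shows "exp (- y) \<le> fact m / y ^ m"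
proof -
  have "y ^ m / fact m \<le> exp y"
  proof -
    have "(\<Sum>k\<in>{m}. y ^ k /\<^sub>R fact k) \<le> (\<Sum>k. y ^ k /\<^sub>R fact k)"
      using assms by (intro sum_le_suminf summable_exp_generic) auto
    then show ?thesis by (simp add: exp_def divide_inverse mult.commute)
  qed
  then show ?thesis using assms by (simp add: exp_minus field_simps)
qed

text \<open>The double exponential beats every power of \<open>e\<^sup>v\<close> as \<open>v \<rightarrow> \<infinity>\<close>; towards \<open>- \<infinity>\<close> the decay
  comes from \<open>exp (b v)\<close> alone.\<close>
lemma exp_minus_exp_le:
  fixes b :: real
  assumes "b > 0"
  shows "\<exists>M. \<forall>v. exp (b * v - exp v) \<le> M * exp (- min b 1 * \<bar>v\<bar>)"
proof -
  define m where "m = nat \<lceil>b\<rceil> + 1"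
  have m: "real m \<ge> b + 1" by (simp add: m_def) linarith
  have "exp (b * v - exp v) \<le> fact m * exp (- min b 1 * \<bar>v\<bar>)" for v
  proof (cases "v \<ge> 0")
    case True
    have "exp (- exp v) \<le> fact m / exp v ^ m" by (rule exp_neg_le_power) simp
    also have "\<dots> = fact m * exp (- (real m * v))" by (simp add: exp_of_nat_mult exp_minus divide_inverse)
    finally have "exp (b * v) * exp (- exp v) \<le> exp (b * v) * (fact m * exp (- (real m * v)))"
      by (intro mult_left_mono) auto
    also have "\<dots> = fact m * exp (b * v - real m * v)" by (simp add: exp_diff exp_minus divide_inverse)
    also have "b * v - real m * v \<le> - min b 1 * \<bar>v\<bar>"
    proof -
      have "(real m - b) * v \<ge> min b 1 * v" using m True by (intro mult_right_mono) auto
      then show ?thesis using True by (simp add: algebra_simps)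
    qed
    finally show ?thesis by (simp add: exp_diff exp_minus divide_inverse)
  next
    case False
    have "min b 1 * \<bar>v\<bar> \<le> b * \<bar>v\<bar>" by (intro mult_right_mono) auto
    moreover have "b * v = - (b * \<bar>v\<bar>)" using False by simp
    ultimately have "b * v - exp v \<le> - min b 1 * \<bar>v\<bar>"
      using exp_gt_zero[of v] unfolding minus_mult_left [symmetric] by linarith
    then have "exp (b * v - exp v) \<le> 1 * exp (- min b 1 * \<bar>v\<bar>)" by simp
    also have "\<dots> \<le> fact m * exp (- min b 1 * \<bar>v\<bar>)" by (intro mult_right_mono) (auto simp: fact_ge_1)
    finally show ?thesis .
  qed
  then show ?thesis by blast
qed

lemma integrable_exp_minus_exp:
  fixes b :: real
  assumes "b > 0"
  shows "integrable lborel (\<lambda>v. exp (b * v - exp v))"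
proof -
  obtain M where M: "\<And>v. exp (b * v - exp v) \<le> M * exp (- min b 1 * \<bar>v\<bar>)"
    using exp_minus_exp_le[OF assms] by blast
  show ?thesis
  proof (rule Bochner_Integration.integrable_bound)
    show "integrable lborel (\<lambda>v. M * exp (- min b 1 * \<bar>v\<bar>))"
      using assms by (intro integrable_mult_right integrable_exp_neg_abs) auto
    show "AE v in lborel. norm (exp (b * v - exp v)) \<le> norm (M * exp (- min b 1 * \<bar>v\<bar>))"
      using order_trans[OF M abs_ge_self] by (intro AE_I2) simp
  qed simp
qed

lemma exp_minus_exp_bounded:
  fixes b :: real
  assumes "b > 0"
  shows "\<exists>M. \<forall>v. exp (b * v - exp v) \<le> M"
proof -
  obtain M where M: "\<And>v. exp (b * v - exp v) \<le> M * exp (- min b 1 * \<bar>v\<bar>)"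
    using exp_minus_exp_le[OF assms] by blast
  have M0: "M \<ge> 0" using order_trans[OF less_imp_le[OF exp_gt_zero] M[of 0]] by simp
  have "exp (b * v - exp v) \<le> M" for v
  proof -
    have "M * exp (- min b 1 * \<bar>v\<bar>) \<le> M * 1" using M0 assms by (intro mult_left_mono) auto
    with M[of v] show ?thesis by simp
  qed
  then show ?thesis by blast
qed

text \<open>Replacing \<open>exp (- x e\<^bsup>-v\<^esup>)\<close> by a multiple of \<open>e\<^bsup>m v\<^esup>\<close> moves the exponent \<open>Re z\<close> to
  \<open>m + Re z > 0\<close>, which makes the integral converge for every order.\<close>
lemma integrable_macdonald:
  fixes z :: complex and x :: real
  assumes x: "x > 0"
  shows "integrable lborel (\<lambda>v. exp (z * of_real v - of_real (exp v) - of_real (x * exp (- v))))"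
proof -
  define m where "m = nat \<lceil>\<bar>Re z\<bar>\<rceil> + 1"
  have m: "real m + Re z \<ge> 1" by (simp add: m_def) linarith
  have "x * exp (- v) > 0" for v using x by simp
  from exp_neg_le_power[OF this, of _ m]
  have e: "exp (- (x * exp (- v))) \<le> fact m / x ^ m * exp (real m * v)" for v
    unfolding power_mult_distrib exp_of_nat_mult
    by (simp add: exp_minus power_inverse divide_inverse mult_ac)
  show ?thesis
  proof (rule Bochner_Integration.integrable_bound)
    show "integrable lborel (\<lambda>v. fact m / x ^ m * exp ((real m + Re z) * v - exp v))"
      using m by (intro integrable_mult_right integrable_exp_minus_exp) auto
    show "AE v in lborel. norm (exp (z * of_real v - of_real (exp v) - of_real (x * exp (- v))))
        \<le> norm (fact m / x ^ m * exp ((real m + Re z) * v - exp v))"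
    proof (rule AE_I2)
      fix v :: real
      have "norm (exp (z * of_real v - of_real (exp v) - of_real (x * exp (- v))))
         = exp (Re z * v - exp v) * exp (- (x * exp (- v)))"
        by (simp add: exp_add [symmetric])
      also have "\<dots> \<le> exp (Re z * v - exp v) * (fact m / x ^ m * exp (real m * v))"
        by (intro mult_left_mono e) simp
      also have "\<dots> = fact m / x ^ m * exp ((real m + Re z) * v - exp v)"
        by (simp add: exp_add exp_diff ring_distribs mult_ac)
      also have "\<dots> \<le> norm \<dots>" unfolding real_norm_def by (rule abs_ge_self)
      finally show "norm (exp (z * of_real v - of_real (exp v) - of_real (x * exp (- v))))
        \<le> norm (fact m / x ^ m * exp ((real m + Re z) * v - exp v))" .
    qed
  qed simp
qed

text \<open>The hyperbolic cosine of \<open>z u\<close> symmetrises \<open>exp (z u)\<close>, so folding the two-sided integral at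
  \<open>u = 0\<close> gives twice the defining integral.\<close>
lemma bessel_K_two_sided:
  assumes int: "integrable lborel (\<lambda>u. exp (z * of_real u - of_real (X * cosh u)))"
  shows "2 * bessel_K z X = (LINT u|lborel. exp (z * of_real u - of_real (X * cosh u)))"
proof -
  define g where "g = (\<lambda>u. exp (z * of_real u - of_real (X * cosh u)))"
  have g: "integrable lborel g" using int by (simp add: g_def)
  have g': "integrable lborel (\<lambda>u. g (- u))"
    using lborel_integrable_real_affine[OF g, of "- 1" 0] by simp
  have part: "integrable lborel (\<lambda>u. indicator A u *\<^sub>R g u)"
    "integrable lborel (\<lambda>u. indicator A u *\<^sub>R g (- u))" if "A \<in> sets borel" for A
    using that g g' by (auto intro!: integrable_mult_indicator)
  have "(LINT u|lborel. g u) = (LINT u|lborel. indicator {0..} u *\<^sub>R g u + indicator {..<0} u *\<^sub>R g u)"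
    by (intro Bochner_Integration.integral_cong) (auto simp: indicator_def)
  also have "\<dots> = (LINT u|lborel. indicator {0..} u *\<^sub>R g u) + (LINT u|lborel. indicator {..<0} u *\<^sub>R g u)"
    by (intro Bochner_Integration.integral_add part) auto
  also have "(LINT u|lborel. indicator {..<0} u *\<^sub>R g u)
      = (LINT u|lborel. indicator {..<0} (- u) *\<^sub>R g (- u))"
    using lborel_integral_real_affine[of "- 1" "\<lambda>u. indicator {..<0} u *\<^sub>R g u" 0] by simp
  also have "\<dots> = (LINT u|lborel. indicator {0..} u *\<^sub>R g (- u))"
  proof (rule integral_cong_AE)
    show "AE u in lborel. indicator {..<0} (- u) *\<^sub>R g (- u) = indicator {0..} u *\<^sub>R g (- u)"
      using AE_lborel_singleton[of "0::real"] by eventually_elim (auto simp: indicator_def)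
  qed (use g' in \<open>auto dest: borel_measurable_integrable\<close>)
  also have "(LINT u|lborel. indicator {0..} u *\<^sub>R g u) + \<dots>
      = (LINT u|lborel. indicator {0..} u *\<^sub>R g u + indicator {0..} u *\<^sub>R g (- u))"
    by (intro Bochner_Integration.integral_add [symmetric] part) auto
  also have "\<dots> = (LINT u|lborel. 2 * (indicator {0..} u *\<^sub>R
      (complex_of_real (exp (- X * cosh u)) * cosh (z * complex_of_real u))))"
    by (intro Bochner_Integration.integral_cong refl)
       (auto simp: g_def indicator_def cosh_def[of "z * _"] exp_diff exp_minus scaleR_conv_of_real field_simps
          simp flip: exp_of_real)
  also have "\<dots> = 2 * bessel_K z X"
    unfolding bessel_K_def set_lebesgue_integral_def by (rule integral_mult_right_zero)
  finally show ?thesis by (simp add: g_def)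
qed

text \<open>The shift \<open>u = v - ln x / 2\<close> absorbs the factor \<open>x\<^bsup>z/2\<^esup>\<close> and turns \<open>2 \<surd>x cosh u\<close> into
  \<open>e\<^sup>v + x e\<^bsup>-v\<^esup>\<close>: the variable \<open>x\<close> then occurs only in the Laplace kernel \<open>exp (- x e\<^bsup>-v\<^esup>)\<close>.\<close>
lemma bessel_K_exp_form:
  fixes z :: complex and x :: real
  assumes x: "x > 0"
  shows "2 * (complex_of_real x powr (z / 2) * bessel_K z (2 * sqrt x))
     = (LINT v|lborel. exp (z * of_real v - of_real (exp v) - of_real (x * exp (- v))))"
proof -
  define s where "s = ln x / 2"
  define g where "g = (\<lambda>u. exp (z * of_real u - of_real (2 * sqrt x * cosh u)))"
  have es: "exp s = sqrt x"
    using x by (simp add: s_def ln_sqrt [symmetric])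
  have pw: "complex_of_real x powr (z / 2) = exp (z * of_real s)"
    using x by (simp add: powr_of_real_eq_exp s_def)
  have ch: "2 * sqrt x * cosh (- s + v) = exp v + x * exp (- v)" for v
  proof -
    have "2 * sqrt x * cosh (- s + v) = exp s * exp (- s + v) + exp s * exp (s - v)"
      by (simp add: cosh_def es [symmetric] field_simps)
    also have "\<dots> = exp v + (exp s * exp s) * exp (- v)"
      by (simp add: exp_add [symmetric] exp_diff exp_minus field_simps)
    finally show ?thesis using x by (simp add: es)
  qed
  have shift: "exp (z * of_real s) * g (- s + 1 * v) = exp (z * of_real v - of_real (exp v) - of_real (x * exp (- v)))" for v
  proof -
    have "g (- s + 1 * v) = exp (z * of_real (- s + v) - of_real (exp v + x * exp (- v)))"
      unfolding g_def by (simp only: mult_1 ch)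
    then show ?thesis by (simp add: exp_add [symmetric] algebra_simps)
  qed
  have "integrable lborel (\<lambda>v. exp (z * of_real s) * g (- s + 1 * v))"
    unfolding shift by (rule integrable_macdonald[OF x])
  then have "integrable lborel (\<lambda>v. inverse (exp (z * of_real s)) * (exp (z * of_real s) * g (- s + 1 * v)))"
    by (rule integrable_mult_right)
  then have "integrable lborel (\<lambda>v. g (- s + 1 * v))" by (simp add: mult.assoc [symmetric])
  then have int: "integrable lborel g" by (subst (asm) lborel_integrable_real_affine_iff) auto
  have "2 * bessel_K z (2 * sqrt x) = (LINT u|lborel. g u)"
    unfolding g_def by (rule bessel_K_two_sided[OF int[unfolded g_def]])
  also have "\<dots> = (LINT v|lborel. g (- s + 1 * v))"
    using lborel_integral_real_affine[of 1 g "- s"] by simp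
  finally have "2 * (complex_of_real x powr (z / 2) * bessel_K z (2 * sqrt x))
     = exp (z * of_real s) * (LINT v|lborel. g (- s + 1 * v))"
    by (simp add: pw)
  also have "\<dots> = (LINT v|lborel. exp (z * of_real s) * g (- s + 1 * v))"
    by (rule integral_mult_right_zero [symmetric])
  finally show ?thesis by (simp only: shift)
qed

section \<open>The index transform as the Fourier transform of a Laplace transform\<close>

definition laplace :: "(real \<Rightarrow> complex) \<Rightarrow> real \<Rightarrow> complex" where
  "laplace f p = (LINT x:{0<..}|lborel. complex_of_real (exp (- (p * x))) * f x)"

text \<open>The two consequences of membership in the class on which everything else is based. On the line
  \<open>Re s = c\<close> the modulus of \<open>x\<^bsup>-s\<^esup>\<close> is \<open>x\<^bsup>-c\<^esup>\<close>, independent of \<open>Im s\<close>.\<close>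
lemma inv_mellin_L1_regular:
  assumes "f \<in> inv_mellin_L1 c"
  shows "continuous_on {0<..} f" and "\<exists>C. \<forall>x>0. norm (f x) \<le> C * x powr (- c)"
proof -
  obtain fs where fs: "integrable lborel (\<lambda>\<sigma>. fs (Complex c \<sigma>))"
    and f: "\<And>x. x > 0 \<Longrightarrow> f x = 1 / (2 * complex_of_real pi * \<i>) *
      (LINT \<sigma>|lborel. fs (Complex c \<sigma>) * complex_of_real x powr (- Complex c \<sigma>) * \<i>)"
    using assms by (auto simp: inv_mellin_L1_def L1_vline_def vline_integral_def)
  define K where "K = (\<lambda>x \<sigma>. fs (Complex c \<sigma>) * exp (- Complex c \<sigma> * of_real (ln x)) * \<i>)"
  have [measurable]: "(\<lambda>\<sigma>. fs (Complex c \<sigma>)) \<in> borel_measurable borel"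
    using fs by (auto dest: borel_measurable_integrable)
  have [measurable]: "Complex c \<in> borel_measurable borel"
    by (intro borel_measurable_continuous_onI) (simp add: Complex_eq [abs_def] continuous_intros)
  have f_K: "f x = 1 / (2 * complex_of_real pi * \<i>) * (LINT \<sigma>|lborel. K x \<sigma>)" if "x > 0" for x
    using f[OF that] that by (simp add: K_def powr_of_real_eq_exp)
  have norm_K: "norm (K x \<sigma>) = norm (fs (Complex c \<sigma>)) * x powr (- c)" if "x > 0" for x \<sigma>
    using that by (simp add: K_def norm_mult powr_def)
  have meas: "K x \<in> borel_measurable lborel" for x unfolding K_def by measurable
  have int_K: "integrable lborel (K x)" if "x > 0" for x
    by (rule Bochner_Integration.integrable_bound[OF integrable_mult_left[OF integrable_norm[OF fs], of "x powr (- c)"] meas])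
       (simp add: norm_K[OF that])
  show "\<exists>C. \<forall>x>0. norm (f x) \<le> C * x powr (- c)"
  proof (intro exI allI impI)
    fix x :: real assume x: "x > 0"
    have "norm (LINT \<sigma>|lborel. K x \<sigma>) \<le> (LINT \<sigma>|lborel. norm (K x \<sigma>))"
      by (rule integral_norm_bound)
    also have "\<dots> = (LINT \<sigma>|lborel. norm (fs (Complex c \<sigma>))) * x powr (- c)"
      by (simp add: norm_K[OF x])
    finally show "norm (f x) \<le> 1 / (2 * pi) * (LINT \<sigma>|lborel. norm (fs (Complex c \<sigma>))) * x powr (- c)"
      unfolding f_K[OF x] by (simp add: norm_mult norm_divide divide_right_mono)
  qed
  have "continuous_on {0<..} (\<lambda>x. LINT \<sigma>|lborel. K x \<sigma>)"
  proof (rule continuous_on_LINT_dominated)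
    show "continuous_on {0<..} (\<lambda>x. K x \<sigma>)" for \<sigma>
      unfolding K_def by (intro continuous_intros) auto
    fix a :: real assume "a \<in> {0<..}"
    then have a: "a > 0" by simp
    show "\<exists>w. integrable lborel w \<and> (\<forall>\<^sub>F x in at a within {0<..}. \<forall>y. norm (K x y) \<le> w y)"
    proof (intro exI conjI)
      show "integrable lborel (\<lambda>\<sigma>. norm (fs (Complex c \<sigma>)) * (a powr (- c) + 1))"
        by (intro integrable_mult_left integrable_norm fs)
      have "((\<lambda>x. x powr (- c)) \<longlongrightarrow> a powr (- c)) (at a within {0<..})"
        using a by (intro tendsto_intros) auto
      then have "\<forall>\<^sub>F x in at a within {0<..}. x powr (- c) < a powr (- c) + 1"
        by (rule order_tendstoD) simp
      moreover have "\<forall>\<^sub>F x in at a within {0<..}. x \<in> {0<..}"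
        by (simp add: eventually_at_filter)
      ultimately show "\<forall>\<^sub>F x in at a within {0<..}. \<forall>y. norm (K x y) \<le> norm (fs (Complex c y)) * (a powr (- c) + 1)"
        by eventually_elim (auto simp: norm_K intro!: mult_left_mono)
    qed
  qed (rule meas)
  then have "continuous_on {0<..} (\<lambda>x. 1 / (2 * complex_of_real pi * \<i>) * (LINT \<sigma>|lborel. K x \<sigma>))"
    by (intro continuous_intros) auto
  then show "continuous_on {0<..} f"
    by (rule continuous_on_eq) (simp add: f_K)
qed

context
  fixes f :: "real \<Rightarrow> complex" and c C :: real
  assumes c: "c < 1" and cont: "continuous_on {0<..} f"
    and bound: "\<And>x. x > 0 \<Longrightarrow> norm (f x) \<le> C * x powr (- c)"
begin

lemma laplace_integrand_le:
  "norm (indicator {0<..} x *\<^sub>R (complex_of_real (exp (- (p * x))) * f x))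
    \<le> C * (indicator {0<..} x *\<^sub>R (exp (- (p * x)) * x powr ((1 - c) - 1)))"
proof (cases "x > 0")
  case True
  then have "exp (- (p * x)) * norm (f x) \<le> exp (- (p * x)) * (C * x powr (- c))"
    by (intro mult_left_mono bound) auto
  then show ?thesis using True by (simp add: norm_mult mult_ac)
qed simp

lemma laplace_dominant:
  assumes "p > 0"
  shows "integrable lborel (\<lambda>x. C * (indicator {0<..} x *\<^sub>R (exp (- (p * x)) * x powr ((1 - c) - 1))))"
    and "(LINT x|lborel. C * (indicator {0<..} x *\<^sub>R (exp (- (p * x)) * x powr ((1 - c) - 1))))
      = C * (Gamma (1 - c) * p powr (c - 1))"
proof -
  note L = laplace_powr_real[of "1 - c" p]
  show "integrable lborel (\<lambda>x. C * (indicator {0<..} x *\<^sub>R (exp (- (p * x)) * x powr ((1 - c) - 1))))"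
    using L(1) c assms unfolding set_integrable_def by (intro integrable_mult_right) simp
  have "(LINT x|lborel. C * (indicator {0<..} x *\<^sub>R (exp (- (p * x)) * x powr ((1 - c) - 1))))
      = C * (LINT x:{0<..}|lborel. exp (- (p * x)) * x powr ((1 - c) - 1))"
    unfolding set_lebesgue_integral_def by (rule integral_mult_right_zero)
  also have "\<dots> = C * (Gamma (1 - c) * p powr (- (1 - c)))" using L(2) c assms by simp
  finally show "(LINT x|lborel. C * (indicator {0<..} x *\<^sub>R (exp (- (p * x)) * x powr ((1 - c) - 1))))
      = C * (Gamma (1 - c) * p powr (c - 1))" by simp
qed

lemma laplace_measurable:
  "(\<lambda>x. indicator {0<..} x *\<^sub>R (complex_of_real (exp (- (p * x))) * f x)) \<in> borel_measurable lborel"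
proof -
  note [measurable] = measurable_pos_continuous[OF cont]
  have "(\<lambda>x. complex_of_real (exp (- (p * x))) * (indicator {0<..} x *\<^sub>R f x)) \<in> borel_measurable lborel"
    by measurable
  then show ?thesis by (simp only: mult_scaleR_right)
qed

lemma laplace_integrable:
  assumes "p > 0"
  shows "set_integrable lborel {0<..} (\<lambda>x. complex_of_real (exp (- (p * x))) * f x)"
  unfolding set_integrable_def
  using order_trans[OF laplace_integrand_le abs_ge_self]
  by (intro Bochner_Integration.integrable_bound[OF laplace_dominant(1)[OF assms] laplace_measurable] AE_I2)
     (simp only: real_norm_def)

lemma norm_laplace_le:
  assumes "p > 0"
  shows "norm (laplace f p) \<le> C * (Gamma (1 - c) * p powr (c - 1))"
proof -
  have "norm (laplace f p) \<le> (LINT x|lborel. norm (indicator {0<..} x *\<^sub>R (complex_of_real (exp (- (p * x))) * f x)))"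
    unfolding laplace_def set_lebesgue_integral_def by (rule integral_norm_bound)
  also have "\<dots> \<le> (LINT x|lborel. C * (indicator {0<..} x *\<^sub>R (exp (- (p * x)) * x powr ((1 - c) - 1))))"
    using laplace_integrable[OF assms] unfolding set_integrable_def
    by (intro integral_mono integrable_norm laplace_dominant(1)[OF assms] laplace_integrand_le)
  finally show ?thesis unfolding laplace_dominant(2)[OF assms] .
qed

lemma C_nonneg: "C \<ge> 0"
  using order_trans[OF norm_ge_zero bound[of 1]] by simp

lemma continuous_on_laplace: "continuous_on {0<..} (laplace f)"
  unfolding laplace_def set_lebesgue_integral_def
proof (rule continuous_on_LINT_dominated)
  show "continuous_on {0<..} (\<lambda>p. indicator {0<..} x *\<^sub>R (complex_of_real (exp (- (p * x))) * f x))" for x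
    by (intro continuous_intros)
  fix a :: real assume "a \<in> {0<..}"
  then have a: "a > 0" by simp
  show "\<exists>w. integrable lborel w \<and> (\<forall>\<^sub>F p in at a within {0<..}. \<forall>x.
      norm (indicator {0<..} x *\<^sub>R (complex_of_real (exp (- (p * x))) * f x)) \<le> w x)"
  proof (intro exI conjI)
    show "integrable lborel (\<lambda>x. C * (indicator {0<..} x *\<^sub>R (exp (- (a / 2 * x)) * x powr ((1 - c) - 1))))"
      using a by (intro laplace_dominant(1)) simp
    have "\<forall>\<^sub>F p in at a within {0<..}. a / 2 < p"
      using a by (intro order_tendstoD[of _ a]) (auto intro: tendsto_ident_at)
    then show "\<forall>\<^sub>F p in at a within {0<..}. \<forall>x. norm (indicator {0<..} x *\<^sub>R (complex_of_real (exp (- (p * x))) * f x))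
       \<le> C * (indicator {0<..} x *\<^sub>R (exp (- (a / 2 * x)) * x powr ((1 - c) - 1)))"
    proof eventually_elim
      case (elim p)
      have "C * (indicator {0<..} x *\<^sub>R (exp (- (p * x)) * x powr ((1 - c) - 1)))
         \<le> C * (indicator {0<..} x *\<^sub>R (exp (- (a / 2 * x)) * x powr ((1 - c) - 1)))" for x
        using elim by (cases "x > 0") (auto intro!: mult_left_mono mult_right_mono C_nonneg)
      then show ?case using order_trans[OF laplace_integrand_le] by blast
    qed
  qed
qed (rule laplace_measurable)

text \<open>Fubini, with the \<open>x\<close>-integral taken first. The majorant integrates in \<open>x\<close> to a multiple of
  \<open>exp ((Re z + 1 - c) v - e\<^sup>v)\<close>, so the condition on \<open>Re z\<close> is exactly what convergence as
  \<open>v \<rightarrow> - \<infinity>\<close> requires.\<close>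
lemma F_transform_eq_fourier:
  assumes z: "Re z > c - 1"
  shows "F_transform f z
    = (LINT v|lborel. exp (z * of_real v - of_real (exp v)) * laplace f (exp (- v)))"
proof -
  define b where "b = Re z"
  define K where "K = (\<lambda>v x. exp (z * of_real v - of_real (exp v))
      * (indicator {0<..} x *\<^sub>R (complex_of_real (exp (- (exp (- v) * x))) * f x)))"
  define B where "B = (\<lambda>v x. exp (b * v - exp v) * (C * (indicator {0<..} x *\<^sub>R (exp (- (exp (- v) * x)) * x powr ((1 - c) - 1)))))"
  note [measurable] = measurable_pos_continuous[OF cont]
  have "F_transform f z = (LINT x:{0<..}|lborel. 2 * (complex_of_real x powr (z / 2) * bessel_K z (2 * sqrt x) * f x))"
    unfolding F_transform_def set_lebesgue_integral_def
    by (simp only: mult_scaleR_right [symmetric] integral_mult_right_zero)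
  also have "\<dots> = (LINT x|lborel. LINT v|lborel. K v x)"
    unfolding set_lebesgue_integral_def
  proof (rule Bochner_Integration.integral_cong[OF refl])
    fix x :: real
    show "indicator {0<..} x *\<^sub>R (2 * (complex_of_real x powr (z / 2) * bessel_K z (2 * sqrt x) * f x)) = (LINT v|lborel. K v x)"
    proof (cases "x > 0")
      case True
      have "indicator {0<..} x *\<^sub>R (2 * (complex_of_real x powr (z / 2) * bessel_K z (2 * sqrt x) * f x))
         = (2 * (complex_of_real x powr (z / 2) * bessel_K z (2 * sqrt x))) * f x"
        using True by simp
      also have "\<dots> = (LINT v|lborel. exp (z * of_real v - of_real (exp v) - of_real (x * exp (- v))) * f x)"
        unfolding bessel_K_exp_form[OF True] by (rule integral_mult_left_zero [symmetric])
      also have "\<dots> = (LINT v|lborel. K v x)"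
      proof (rule Bochner_Integration.integral_cong[OF refl])
        fix v :: real
        have "exp (z * of_real v - of_real (exp v) - of_real (x * exp (- v)))
           = exp (z * of_real v - of_real (exp v)) * complex_of_real (exp (- (exp (- v) * x)))"
          unfolding exp_of_real [symmetric] exp_add [symmetric] by (simp add: mult_ac)
        then show "exp (z * of_real v - of_real (exp v) - of_real (x * exp (- v))) * f x = K v x"
          using True by (simp add: K_def mult_ac)
      qed
      finally show ?thesis .
    qed (simp add: K_def)
  qed
  also have "\<dots> = (LINT v|lborel. LINT x|lborel. K v x)"
  proof (rule lborel_integral_swap_dominated[where B = B, symmetric])
    have "(\<lambda>(v, x). exp (z * of_real v - of_real (exp v))
      * (complex_of_real (exp (- (exp (- v) * x))) * (indicator {0<..} x *\<^sub>R f x))) \<in> borel_measurable (lborel \<Otimes>\<^sub>M lborel)"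
      by measurable
    then show "(\<lambda>(v, x). K v x) \<in> borel_measurable (lborel \<Otimes>\<^sub>M lborel)"
      by (simp only: K_def mult_scaleR_right)
    show "norm (K v x) \<le> B v x" for v x
    proof -
      have "norm (exp (z * of_real v - of_real (exp v))) = exp (b * v - exp v)" by (simp add: b_def)
      then show ?thesis unfolding K_def B_def norm_mult[of "exp _"]
        using laplace_integrand_le[of x "exp (- v)"] by (simp only: mult_left_mono exp_ge_zero)
    qed
    show "integrable lborel (B v)" for v
      unfolding B_def by (intro integrable_mult_right laplace_dominant(1)) simp
    have "(LINT x|lborel. B v x) = C * Gamma (1 - c) * exp ((b + 1 - c) * v - exp v)" for v
    proof -
      have "(LINT x|lborel. B v x) = exp (b * v - exp v) * (C * (Gamma (1 - c) * exp (- v) powr (c - 1)))"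
        unfolding B_def by (subst integral_mult_right_zero) (simp only: laplace_dominant(2) exp_gt_zero)
      also have "exp (- v) powr (c - 1) = exp ((1 - c) * v)"
        by (simp add: powr_def algebra_simps)
      also have "exp (b * v - exp v) * (C * (Gamma (1 - c) * exp ((1 - c) * v)))
         = C * Gamma (1 - c) * (exp (b * v - exp v) * exp ((1 - c) * v))" by (simp only: mult_ac)
      also have "exp (b * v - exp v) * exp ((1 - c) * v) = exp ((b + 1 - c) * v - exp v)"
        unfolding exp_add [symmetric] by (simp add: algebra_simps)
      finally show ?thesis .
    qed
    then show "integrable lborel (\<lambda>v. LINT x|lborel. B v x)"
      using z by (simp only:) (intro integrable_mult_right integrable_exp_minus_exp, simp add: b_def)
  qed
  also have "\<dots> = (LINT v|lborel. exp (z * of_real v - of_real (exp v)) * laplace f (exp (- v)))"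
    unfolding K_def laplace_def set_lebesgue_integral_def by (simp only: integral_mult_right_zero)
  finally show ?thesis .
qed

end

text \<open>The function \<open>G\<close> whose Fourier transform is \<open>(Ff)(\<gamma> + i \<tau>)\<close>, see \<open>F_transform_vline\<close>.\<close>
definition fourier_density :: "(real \<Rightarrow> complex) \<Rightarrow> real \<Rightarrow> real \<Rightarrow> complex" where
  "fourier_density f \<gamma> v = complex_of_real (exp (\<gamma> * v - exp v)) * laplace f (exp (- v))"

context
  fixes f :: "real \<Rightarrow> complex" and c C \<gamma> :: real
  assumes c: "c < 1" and cont: "continuous_on {0<..} f"
    and bound: "\<And>x. x > 0 \<Longrightarrow> norm (f x) \<le> C * x powr (- c)"
    and \<gamma>: "\<gamma> > c - 1"
begin

lemma norm_fourier_density_le: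
  "norm (fourier_density f \<gamma> v) \<le> C * Gamma (1 - c) * exp ((\<gamma> + 1 - c) * v - exp v)"
proof -
  have "norm (fourier_density f \<gamma> v) \<le> exp (\<gamma> * v - exp v) * (C * (Gamma (1 - c) * exp (- v) powr (c - 1)))"
    unfolding fourier_density_def norm_mult using norm_laplace_le[OF c cont bound, of "exp (- v)"]
    by (intro mult_mono) auto
  also have "exp (- v) powr (c - 1) = exp ((1 - c) * v)"
    by (simp add: powr_def algebra_simps)
  also have "exp (\<gamma> * v - exp v) * (C * (Gamma (1 - c) * exp ((1 - c) * v)))
       = C * Gamma (1 - c) * (exp (\<gamma> * v - exp v) * exp ((1 - c) * v))" by (simp only: mult_ac)
  also have "exp (\<gamma> * v - exp v) * exp ((1 - c) * v) = exp ((\<gamma> + 1 - c) * v - exp v)"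
    unfolding exp_add [symmetric] by (simp add: algebra_simps)
  finally show ?thesis .
qed

lemma continuous_on_fourier_density: "continuous_on UNIV (fourier_density f \<gamma>)"
  unfolding fourier_density_def
  by (intro continuous_intros continuous_on_compose2[OF continuous_on_laplace[OF c cont bound]]) auto

lemma integrable_fourier_density: "integrable lborel (fourier_density f \<gamma>)"
proof (rule Bochner_Integration.integrable_bound)
  show "integrable lborel (\<lambda>v. C * Gamma (1 - c) * exp ((\<gamma> + 1 - c) * v - exp v))"
    using \<gamma> by (intro integrable_mult_right integrable_exp_minus_exp) auto
  show "fourier_density f \<gamma> \<in> borel_measurable lborel"
    using borel_measurable_continuous_onI[OF continuous_on_fourier_density] by simp
  show "AE v in lborel. norm (fourier_density f \<gamma> v)
      \<le> norm (C * Gamma (1 - c) * exp ((\<gamma> + 1 - c) * v - exp v))"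
    unfolding real_norm_def by (intro AE_I2 order_trans[OF norm_fourier_density_le abs_ge_self])
qed

lemma fourier_density_bounded: "\<exists>B. \<forall>v. norm (fourier_density f \<gamma> v) \<le> B"
proof -
  have "\<gamma> + 1 - c > 0" using \<gamma> by simp
  then obtain M where M: "\<And>v. exp ((\<gamma> + 1 - c) * v - exp v) \<le> M"
    using exp_minus_exp_bounded by blast
  have "C \<ge> 0" by (rule C_nonneg[OF c cont bound])
  then have "C * Gamma (1 - c) * exp ((\<gamma> + 1 - c) * v - exp v) \<le> C * Gamma (1 - c) * M" for v
    using M c by (intro mult_left_mono mult_nonneg_nonneg less_imp_le[OF Gamma_real_pos]) auto
  then show ?thesis using order_trans[OF norm_fourier_density_le] by blast
qed

lemma F_transform_vline:
  "F_transform f (Complex \<gamma> \<tau>) = (LINT v|lborel. iexp (\<tau> * v) * fourier_density f \<gamma> v)"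
proof -
  have "F_transform f (Complex \<gamma> \<tau>)
      = (LINT v|lborel. exp (Complex \<gamma> \<tau> * of_real v - of_real (exp v)) * laplace f (exp (- v)))"
    using \<gamma> by (intro F_transform_eq_fourier[OF c cont bound]) auto
  also have "\<dots> = (LINT v|lborel. iexp (\<tau> * v) * fourier_density f \<gamma> v)"
  proof (rule Bochner_Integration.integral_cong[OF refl])
    fix v :: real
    have "exp (Complex \<gamma> \<tau> * of_real v - of_real (exp v)) = iexp (\<tau> * v) * complex_of_real (exp (\<gamma> * v - exp v))"
      unfolding exp_of_real [symmetric] exp_add [symmetric]
      by (simp add: Complex_eq exp_of_real algebra_simps)
    then show "exp (Complex \<gamma> \<tau> * of_real v - of_real (exp v)) * laplace f (exp (- v))
        = iexp (\<tau> * v) * fourier_density f \<gamma> v"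
      by (simp add: fourier_density_def)
  qed
  finally show ?thesis .
qed

end

section \<open>Superpositions of inversion kernels\<close>

text \<open>Up to the factor \<open>1 / (2 \<pi>)\<close>, the right-hand side of the inversion formula for
  \<open>\<Phi>(\<tau>) = (Ff)(\<gamma> + i \<tau>)\<close>.\<close>
definition kernel_superposition :: "real \<Rightarrow> (real \<Rightarrow> complex) \<Rightarrow> real \<Rightarrow> complex" where
  "kernel_superposition \<gamma> \<Phi> t = (LINT \<tau>|lborel. inv_kernel (Complex \<gamma> \<tau>) t * \<Phi> \<tau>)"

context
  fixes \<gamma> :: real and \<Phi> :: "real \<Rightarrow> complex"
  assumes \<gamma>: "\<gamma> < 0" and meas_\<Phi> [measurable]: "\<Phi> \<in> borel_measurable borel"
    and int_U: "integrable lborel (\<lambda>\<tau>. rGamma (- Complex \<gamma> \<tau>) * \<Phi> \<tau>)"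
begin

text \<open>\<open>U\<close> and \<open>q\<close> are the two factors of a product majorant of \<open>inv_kernel (\<gamma> + i \<tau>) t * \<Phi>(\<tau>)\<close>, and
  \<open>V p\<close> is the integrand of the Laplace transform of \<open>q\<close>.\<close>
private abbreviation U :: "real \<Rightarrow> complex" where
  "U \<equiv> \<lambda>\<tau>. rGamma (- Complex \<gamma> \<tau>) * \<Phi> \<tau>"

private abbreviation R :: "real \<Rightarrow> complex" where
  "R \<equiv> kernel_superposition \<gamma> \<Phi>"

private definition q :: "real \<Rightarrow> real" where
  "q t = Gamma (- \<gamma>) * norm (inv_kernel (of_real \<gamma>) t)"

private definition V :: "real \<Rightarrow> real \<Rightarrow> real" where
  "V p t = indicator {0<..} t *\<^sub>R (exp (- (p * t)) * q t)"

private lemma kernel_le: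
  assumes "t > 0"
  shows "norm (inv_kernel (Complex \<gamma> \<tau>) t * \<Phi> \<tau>) \<le> norm (U \<tau>) * q t"
proof -
  have "norm (inv_kernel (Complex \<gamma> \<tau>) t) * norm (\<Phi> \<tau>)
      \<le> (norm (rGamma (- Complex \<gamma> \<tau>)) * q t) * norm (\<Phi> \<tau>)"
    using norm_inv_kernel_le[of "Complex \<gamma> \<tau>" t] \<gamma> assms unfolding q_def
    by (intro mult_right_mono) auto
  then show ?thesis by (simp add: norm_mult mult_ac)
qed

private lemma meas_kernel:
  "(\<lambda>\<tau>. inv_kernel (Complex \<gamma> \<tau>) t * \<Phi> \<tau>) \<in> borel_measurable lborel"
proof -
  have "(\<lambda>\<tau>. inv_kernel (Complex \<gamma> \<tau>) t) \<in> borel_measurable lborel"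
    using measurable_compose[OF measurable_Pair2'[of t lborel lborel] measurable_inv_kernel[of \<gamma>]] by simp
  then show ?thesis by measurable
qed

lemma integrable_kernel_superposition:
  assumes "t > 0"
  shows "integrable lborel (\<lambda>\<tau>. inv_kernel (Complex \<gamma> \<tau>) t * \<Phi> \<tau>)"
  using order_trans[OF kernel_le[OF assms] abs_ge_self]
  by (intro Bochner_Integration.integrable_bound[OF integrable_mult_left[OF integrable_norm[OF int_U], of "q t"] meas_kernel] AE_I2)
     (simp only: real_norm_def)

private lemma cont_q: "continuous_on {0<..} q"
  unfolding q_def using \<gamma> by (intro continuous_intros continuous_on_inv_kernel) auto

lemma continuous_on_kernel_superposition: "continuous_on {0<..} R"
  unfolding kernel_superposition_def
proof (rule continuous_on_LINT_dominated)
  show "continuous_on {0<..} (\<lambda>t. inv_kernel (Complex \<gamma> \<tau>) t * \<Phi> \<tau>)" for \<tau>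
    using \<gamma> by (intro continuous_intros continuous_on_inv_kernel) auto
  fix a :: real assume a: "a \<in> {0<..}"
  show "\<exists>W. integrable lborel W \<and> (\<forall>\<^sub>F t in at a within {0<..}.
      \<forall>\<tau>. norm (inv_kernel (Complex \<gamma> \<tau>) t * \<Phi> \<tau>) \<le> W \<tau>)"
  proof (intro exI conjI)
    show "integrable lborel (\<lambda>\<tau>. norm (U \<tau>) * (q a + 1))"
      by (intro integrable_mult_left integrable_norm int_U)
    have "(q \<longlongrightarrow> q a) (at a within {0<..})" using cont_q a by (simp add: continuous_on_def)
    then have "\<forall>\<^sub>F t in at a within {0<..}. q t < q a + 1"
      by (rule order_tendstoD) simp
    moreover have "\<forall>\<^sub>F t in at a within {0<..}. t \<in> {0<..}"
      by (simp add: eventually_at_filter)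
    ultimately show "\<forall>\<^sub>F t in at a within {0<..}.
        \<forall>\<tau>. norm (inv_kernel (Complex \<gamma> \<tau>) t * \<Phi> \<tau>) \<le> norm (U \<tau>) * (q a + 1)"
    proof eventually_elim
      case (elim t)
      then have "norm (U \<tau>) * q t \<le> norm (U \<tau>) * (q a + 1)" for \<tau> by (intro mult_left_mono) auto
      then show ?case using order_trans[OF kernel_le] elim by simp
    qed
  qed
qed (rule meas_kernel)


private lemma int_V:
  assumes "p > 0"
  shows "integrable lborel (V p)"
proof -
  have "Re (complex_of_real \<gamma>) < 0" using \<gamma> by simp
  from integrable_norm[OF laplace_inv_kernel(1)[OF this assms, unfolded set_integrable_def]]
  have "integrable lborel (\<lambda>t. Gamma (- \<gamma>) *
      norm (indicator {0<..} t *\<^sub>R (complex_of_real (exp (- (p * t))) * inv_kernel (of_real \<gamma>) t)))"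
    by (rule integrable_mult_right)
  then show ?thesis by (simp add: V_def [abs_def] q_def norm_mult mult_ac)
qed

private lemma R_le:
  assumes "t > 0"
  shows "norm (R t) \<le> (LINT \<tau>|lborel. norm (U \<tau>)) * q t"
proof -
  have "norm (R t) \<le> (LINT \<tau>|lborel. norm (inv_kernel (Complex \<gamma> \<tau>) t * \<Phi> \<tau>))"
    unfolding kernel_superposition_def by (rule integral_norm_bound)
  also have "\<dots> \<le> (LINT \<tau>|lborel. norm (U \<tau>) * q t)"
    by (intro integral_mono integrable_norm integrable_kernel_superposition assms integrable_mult_left int_U kernel_le)
  finally show ?thesis by simp
qed

lemma laplace_integrable_kernel_superposition:
  assumes p: "p > 0"
  shows "set_integrable lborel {0<..} (\<lambda>t. complex_of_real (exp (- (p * t))) * R t)"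
  unfolding set_integrable_def
proof (rule Bochner_Integration.integrable_bound)
  show "integrable lborel (\<lambda>t. (LINT \<tau>|lborel. norm (U \<tau>)) * V p t)" by (intro integrable_mult_right int_V p)
  have "(\<lambda>t. complex_of_real (exp (- (p * t))) * (indicator {0<..} t *\<^sub>R R t)) \<in> borel_measurable lborel"
    using measurable_pos_continuous[OF continuous_on_kernel_superposition] by measurable
  then show "(\<lambda>t. indicator {0<..} t *\<^sub>R (complex_of_real (exp (- (p * t))) * R t)) \<in> borel_measurable lborel"
    by (simp only: mult_scaleR_right)
  show "AE t in lborel. norm (indicator {0<..} t *\<^sub>R (complex_of_real (exp (- (p * t))) * R t)) \<le> norm ((LINT \<tau>|lborel. norm (U \<tau>)) * V p t)"
  proof (rule AE_I2)
    fix t :: real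
    show "norm (indicator {0<..} t *\<^sub>R (complex_of_real (exp (- (p * t))) * R t)) \<le> norm ((LINT \<tau>|lborel. norm (U \<tau>)) * V p t)"
    proof (cases "t > 0")
      case True
      then have "exp (- (p * t)) * norm (R t) \<le> exp (- (p * t)) * ((LINT \<tau>|lborel. norm (U \<tau>)) * q t)"
        by (intro mult_left_mono R_le) auto
      also have "\<dots> = (LINT \<tau>|lborel. norm (U \<tau>)) * V p t" using True by (simp add: V_def)
      also have "\<dots> \<le> norm \<dots>" unfolding real_norm_def by (rule abs_ge_self)
      finally show ?thesis using True by (simp add: norm_mult)
    qed simp
  qed
qed


text \<open>Fubini and the transform of a single kernel, where \<open>p\<^bsup>\<gamma> + i \<tau>\<^esup>\<close> is split into \<open>p\<^sup>\<gamma>\<close> and the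
  Fourier factor at frequency \<open>- ln p\<close>.\<close>
lemma laplace_kernel_superposition:
  assumes p: "p > 0"
  shows "laplace R p = exp (1 / of_real p) * complex_of_real (p powr \<gamma>)
    * (LINT \<tau>|lborel. \<Phi> \<tau> * iexp (- (\<tau> * (- ln p))))"
proof -
  define K where "K = (\<lambda>\<tau> t. indicator {0<..} t *\<^sub>R (complex_of_real (exp (- (p * t))) * inv_kernel (Complex \<gamma> \<tau>) t) * \<Phi> \<tau>)"
  have "laplace R p = (LINT t|lborel. LINT \<tau>|lborel. K \<tau> t)"
    unfolding laplace_def set_lebesgue_integral_def
  proof (rule Bochner_Integration.integral_cong[OF refl])
    fix t :: real
    have "(LINT \<tau>|lborel. K \<tau> t) = (LINT \<tau>|lborel. (indicator {0<..} t * complex_of_real (exp (- (p * t)))) * (inv_kernel (Complex \<gamma> \<tau>) t * \<Phi> \<tau>))"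
      by (intro Bochner_Integration.integral_cong) (auto simp: K_def indicator_def)
    also have "\<dots> = (indicator {0<..} t * complex_of_real (exp (- (p * t)))) * R t"
      unfolding kernel_superposition_def by (rule integral_mult_right_zero)
    finally show "indicator {0<..} t *\<^sub>R (complex_of_real (exp (- (p * t))) * R t) = (LINT \<tau>|lborel. K \<tau> t)"
      by (simp add: indicator_def)
  qed
  also have "\<dots> = (LINT \<tau>|lborel. LINT t|lborel. K \<tau> t)"
  proof (rule lborel_integral_swap_dominated[where B = "\<lambda>\<tau> t. norm (U \<tau>) * V p t", symmetric])
    have 1: "(\<lambda>x. inv_kernel (Complex \<gamma> (fst x)) (snd x)) \<in> borel_measurable (lborel \<Otimes>\<^sub>M lborel)"
      using measurable_inv_kernel[of \<gamma>] by (simp add: case_prod_beta')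
    have 2: "(\<lambda>x. indicator {0<..} (snd x) *\<^sub>R complex_of_real (exp (- (p * snd x))))
        \<in> borel_measurable (lborel \<Otimes>\<^sub>M lborel)"
      by measurable
    have 3: "(\<lambda>x. \<Phi> (fst x)) \<in> borel_measurable (lborel \<Otimes>\<^sub>M lborel)"
      by measurable
    have "(\<lambda>(\<tau>, t). inv_kernel (Complex \<gamma> \<tau>) t * (indicator {0<..} t *\<^sub>R complex_of_real (exp (- (p * t)))) * \<Phi> \<tau>)
        \<in> borel_measurable (lborel \<Otimes>\<^sub>M lborel)"
      unfolding case_prod_beta' by (intro borel_measurable_times 1 2 3)
    then show "(\<lambda>(\<tau>, t). K \<tau> t) \<in> borel_measurable (lborel \<Otimes>\<^sub>M lborel)"
      by (simp add: K_def mult_ac)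
    show "norm (K \<tau> t) \<le> norm (U \<tau>) * V p t" for \<tau> t
    proof (cases "t > 0")
      case True
      then have "exp (- (p * t)) * norm (inv_kernel (Complex \<gamma> \<tau>) t * \<Phi> \<tau>) \<le> exp (- (p * t)) * (norm (U \<tau>) * q t)"
        by (intro mult_left_mono kernel_le) auto
      then show ?thesis using True by (simp add: K_def V_def norm_mult mult_ac)
    qed (simp add: K_def V_def)
    show "integrable lborel (\<lambda>t. norm (U \<tau>) * V p t)" for \<tau>
      by (intro integrable_mult_right int_V p)
    show "integrable lborel (\<lambda>\<tau>. LINT t|lborel. norm (U \<tau>) * V p t)"
      unfolding integral_mult_right_zero by (intro integrable_mult_left integrable_norm int_U)
  qed
  also have "\<dots> = (LINT \<tau>|lborel. (exp (1 / of_real p) * complex_of_real (p powr \<gamma>)) * (\<Phi> \<tau> * iexp (- (\<tau> * (- ln p)))))"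
  proof (rule Bochner_Integration.integral_cong[OF refl])
    fix \<tau> :: real
    have "(LINT t|lborel. K \<tau> t) = (exp (1 / of_real p) * of_real p powr (Complex \<gamma> \<tau>)) * \<Phi> \<tau>"
      unfolding K_def integral_mult_left_zero
      using laplace_inv_kernel(2)[of "Complex \<gamma> \<tau>" p] \<gamma> p by (simp add: set_lebesgue_integral_def)
    also have "complex_of_real p powr (Complex \<gamma> \<tau>) = complex_of_real (p powr \<gamma>) * iexp (- (\<tau> * (- ln p)))"
      using p by (simp add: powr_of_real_eq_exp powr_def Ln_of_real exp_of_real [symmetric] exp_add [symmetric] Complex_eq algebra_simps)
    finally show "(LINT t|lborel. K \<tau> t)
        = (exp (1 / of_real p) * complex_of_real (p powr \<gamma>)) * (\<Phi> \<tau> * iexp (- (\<tau> * (- ln p))))"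
      by (simp only: mult_ac)
  qed
  also have "\<dots> = exp (1 / of_real p) * complex_of_real (p powr \<gamma>)
    * (LINT \<tau>|lborel. \<Phi> \<tau> * iexp (- (\<tau> * (- ln p))))"
    by (rule integral_mult_right_zero)
  finally show ?thesis .
qed

end

section \<open>Integrability on the vertical line and the inversion formula\<close>

text \<open>The exponential outweighs any negative power. Hence integrability against the weight implies
  plain integrability over \<open>\<bar>\<tau>\<bar> > 1\<close>.\<close>
lemma vline_weight_ge:
  fixes g :: real
  shows "\<exists>A>0. \<forall>\<tau>. \<bar>\<tau>\<bar> \<ge> 1 \<longrightarrow> A \<le> \<bar>\<tau>\<bar> powr g * exp (pi * \<bar>\<tau>\<bar> / 2)"
proof -
  define m where "m = nat \<lceil>\<bar>g\<bar>\<rceil>"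
  have m: "- g \<le> real m" by (simp add: m_def) linarith
  have "1 / fact m \<le> \<bar>\<tau>\<bar> powr g * exp (pi * \<bar>\<tau>\<bar> / 2)" if \<tau>: "\<bar>\<tau>\<bar> \<ge> 1" for \<tau>
  proof -
    have "exp (- \<bar>\<tau>\<bar>) \<le> fact m / \<bar>\<tau>\<bar> ^ m" using \<tau> by (intro exp_neg_le_power) auto
    then have "\<bar>\<tau>\<bar> ^ m / fact m \<le> exp \<bar>\<tau>\<bar>" using \<tau> by (simp add: exp_minus field_simps)
    also have "\<dots> \<le> exp (pi * \<bar>\<tau>\<bar> / 2)"
      using pi_ge_two mult_right_mono[of 2 pi "\<bar>\<tau>\<bar>"] by simp
    finally have 1: "\<bar>\<tau>\<bar> ^ m / fact m \<le> exp (pi * \<bar>\<tau>\<bar> / 2)" .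
    have "\<bar>\<tau>\<bar> powr (- real m) \<le> \<bar>\<tau>\<bar> powr g" using m \<tau> by (intro powr_mono) auto
    then have "\<bar>\<tau>\<bar> powr (- real m) * (\<bar>\<tau>\<bar> ^ m / fact m) \<le> \<bar>\<tau>\<bar> powr g * exp (pi * \<bar>\<tau>\<bar> / 2)"
      using 1 by (intro mult_mono) auto
    then show ?thesis using \<tau> by (simp add: powr_minus powr_realpow)
  qed
  then show ?thesis by (intro exI[of _ "1 / fact m"]) auto
qed

text \<open>The weighted hypothesis controls only \<open>\<bar>\<tau>\<bar> > 1\<close>; on the compact remainder boundedness is enough.\<close>
lemma integrable_by_weight:
  fixes \<Phi> h :: "real \<Rightarrow> complex" and w :: "real \<Rightarrow> real"
  assumes w: "set_integrable lborel {\<tau>. \<bar>\<tau>\<bar> > 1} (\<lambda>\<tau>. w \<tau> *\<^sub>R \<Phi> \<tau>)"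
    and h: "h \<in> borel_measurable lborel"
    and small: "\<And>\<tau>. \<bar>\<tau>\<bar> \<le> 1 \<Longrightarrow> norm (h \<tau>) \<le> A"
    and large: "\<And>\<tau>. \<bar>\<tau>\<bar> > 1 \<Longrightarrow> norm (h \<tau>) \<le> D * (w \<tau> * norm (\<Phi> \<tau>))"
    and w_nonneg: "\<And>\<tau>. w \<tau> \<ge> 0"
  shows "integrable lborel h"
proof (rule Bochner_Integration.integrable_bound[OF _ h])
  let ?W = "\<lambda>\<tau>. indicator {\<tau>. \<bar>\<tau>\<bar> > 1} \<tau> *\<^sub>R (w \<tau> *\<^sub>R \<Phi> \<tau>)"
  show "integrable lborel (\<lambda>\<tau>. A * indicator {- 1..1} \<tau> + D * norm (?W \<tau>))"
    using w unfolding set_integrable_def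
    by (intro Bochner_Integration.integrable_add integrable_mult_right integrable_norm)
       (auto simp: integrable_indicator_iff)
  show "AE \<tau> in lborel. norm (h \<tau>) \<le> norm (A * indicator {- 1..1} \<tau> + D * norm (?W \<tau>))"
  proof (rule AE_I2)
    fix \<tau> :: real
    show "norm (h \<tau>) \<le> norm (A * indicator {- 1..1} \<tau> + D * norm (?W \<tau>))"
    proof (cases "\<bar>\<tau>\<bar> > 1")
      case True
      then have "A * indicator {- 1..1} \<tau> + D * norm (?W \<tau>) = D * (w \<tau> * norm (\<Phi> \<tau>))"
        using w_nonneg[of \<tau>] by (auto simp: indicator_def)
      then show ?thesis using order_trans[OF large[OF True] abs_ge_self] by (simp only: real_norm_def)
    next
      case False
      then have "A * indicator {- 1..1} \<tau> + D * norm (?W \<tau>) = A"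
        by (auto simp: indicator_def)
      then show ?thesis using order_trans[OF small abs_ge_self, of \<tau>] False
        by (simp only: real_norm_def not_less)
    qed
  qed
qed

theorem theorem3:
  fixes c0 \<gamma> :: real and f :: "real \<Rightarrow> complex"
  assumes "c0 < 1"
    and "f \<in> inv_mellin_L1 c0"
    and "\<gamma> \<in> {c0 - 1<..<0}"
    and "set_integrable lborel {\<tau>::real. \<bar>\<tau>\<bar> > 1}
           (\<lambda>\<tau>. (\<bar>\<tau>\<bar> powr (\<gamma> + 1 / 2) * exp (pi * \<bar>\<tau>\<bar> / 2)) *\<^sub>R F_transform f (Complex \<gamma> \<tau>))"
  shows "\<forall>t>0.
           L1_vline \<gamma> (\<lambda>z. bessel_I (- (1 + z)) (2 * sqrt t) *
                         complex_of_real t powr (- (1 + z) / 2) * F_transform f z) \<and>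
           f t = 1 / (2 * complex_of_real pi * \<i>) *
             vline_integral \<gamma> (\<lambda>z. bessel_I (- (1 + z)) (2 * sqrt t) *
                         complex_of_real t powr (- (1 + z) / 2) * F_transform f z)"
proof -
  have \<gamma>: "\<gamma> < 0" "\<gamma> > c0 - 1" using assms(3) by auto
  note cont = inv_mellin_L1_regular(1)[OF assms(2)]
  obtain C where C: "\<And>x. x > 0 \<Longrightarrow> norm (f x) \<le> C * x powr (- c0)"
    using inv_mellin_L1_regular(2)[OF assms(2)] by blast
  note regular = assms(1) cont C
  \<comment> \<open>\<open>\<Phi>\<close> is the transform restricted to the line of integration, \<open>w\<close> the weight in the hypothesis.\<close>
  define \<Phi> where "\<Phi> = (\<lambda>\<tau>. F_transform f (Complex \<gamma> \<tau>))"
  define w where "w = (\<lambda>\<tau>::real. \<bar>\<tau>\<bar> powr (\<gamma> + 1 / 2) * exp (pi * \<bar>\<tau>\<bar> / 2))"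
  have weighted: "set_integrable lborel {\<tau>. \<bar>\<tau>\<bar> > 1} (\<lambda>\<tau>. w \<tau> *\<^sub>R \<Phi> \<tau>)"
    using assms(4) by (simp only: w_def \<Phi>_def)
  have w_nonneg: "w \<tau> \<ge> 0" for \<tau> by (simp add: w_def)

  define G where "G = fourier_density f \<gamma>"
  have int_G: "integrable lborel G"
    unfolding G_def by (rule integrable_fourier_density[OF regular \<gamma>(2)])
  have cont_G: "continuous_on UNIV G"
    unfolding G_def by (rule continuous_on_fourier_density[OF regular \<gamma>(2)])
  obtain B where B: "\<And>v. norm (G v) \<le> B"
    unfolding G_def using fourier_density_bounded[OF regular \<gamma>(2)] by blast
  have \<Phi>_fourier: "\<Phi> \<tau> = (LINT v|lborel. iexp (\<tau> * v) * G v)" for \<tau>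
    unfolding \<Phi>_def G_def by (rule F_transform_vline[OF regular \<gamma>(2)])
  have [measurable]: "G \<in> borel_measurable borel" using int_G by (auto dest: borel_measurable_integrable)
  have meas_\<Phi> [measurable]: "\<Phi> \<in> borel_measurable borel"
    unfolding \<Phi>_fourier [abs_def] by measurable
  define N where "N = (LINT v|lborel. norm (G v))"
  have \<Phi>_le: "norm (\<Phi> \<tau>) \<le> N" for \<tau>
  proof -
    have "norm (\<Phi> \<tau>) \<le> (LINT v|lborel. norm (iexp (\<tau> * v) * G v))"
      unfolding \<Phi>_fourier by (rule integral_norm_bound)
    then show ?thesis by (simp add: norm_mult N_def)
  qed
  have int_\<Phi>: "integrable lborel \<Phi>"
  proof -
    obtain A where A: "A > 0" "\<And>\<tau>. \<bar>\<tau>\<bar> \<ge> 1 \<Longrightarrow> A \<le> w \<tau>"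
      using vline_weight_ge[of "\<gamma> + 1/2"] by (auto simp: w_def)
    show ?thesis
    proof (rule integrable_by_weight[OF weighted _ \<Phi>_le _ w_nonneg])
      fix \<tau> :: real assume "\<bar>\<tau>\<bar> > 1"
      then have "A * norm (\<Phi> \<tau>) \<le> w \<tau> * norm (\<Phi> \<tau>)" by (intro mult_right_mono A) auto
      then show "norm (\<Phi> \<tau>) \<le> 1 / A * (w \<tau> * norm (\<Phi> \<tau>))" using A(1) by (simp add: field_simps)
    qed simp
  qed

  \<comment> \<open>At \<open>v = - ln p\<close> this expresses \<open>laplace f p\<close> through \<open>\<Phi>\<close>.\<close>
  have inversion: "(LINT \<tau>|lborel. \<Phi> \<tau> * iexp (- (\<tau> * v))) = complex_of_real (2 * pi) * G v" for v
    by (rule fourier_inversion[OF int_G cont_G B \<Phi>_fourier int_\<Phi>])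

  \<comment> \<open>\<open>U\<close> measures the absolute convergence of the inversion integral.\<close>
  define U where "U = (\<lambda>\<tau>. rGamma (- Complex \<gamma> \<tau>) * \<Phi> \<tau>)"
  have cont_rG: "continuous_on UNIV (\<lambda>\<tau>. rGamma (- Complex \<gamma> \<tau>))"
    by (intro continuous_on_compose2[OF continuous_on_rGamma[of UNIV]])
       (auto simp: Complex_eq intro!: continuous_intros)
  then have [measurable]: "(\<lambda>\<tau>. rGamma (- Complex \<gamma> \<tau>)) \<in> borel_measurable borel"
    by (rule borel_measurable_continuous_onI)
  have int_U: "integrable lborel U"
  proof -
    obtain D where D: "\<And>\<tau>. \<bar>\<tau>\<bar> \<ge> 1 \<Longrightarrow>
        cmod (rGamma (Complex (- \<gamma>) \<tau>)) \<le> D * (\<bar>\<tau>\<bar> powr (1/2 - (- \<gamma>)) * exp (pi * \<bar>\<tau>\<bar> / 2))"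
      using norm_rGamma_vline_le[of "- \<gamma>"] \<gamma> by auto
    have "bounded ((\<lambda>\<tau>. rGamma (- Complex \<gamma> \<tau>)) ` {- 1..1})"
      by (intro compact_imp_bounded compact_continuous_image continuous_on_subset[OF cont_rG]) auto
    then obtain A where A: "\<And>\<tau>. \<tau> \<in> {- 1..1} \<Longrightarrow> norm (rGamma (- Complex \<gamma> \<tau>)) \<le> A"
      unfolding bounded_iff by blast
    show ?thesis
    proof (rule integrable_by_weight[OF weighted _ _ _ w_nonneg])
      show "U \<in> borel_measurable lborel" unfolding U_def by measurable
      fix \<tau> :: real
      show "norm (U \<tau>) \<le> A * N" if "\<bar>\<tau>\<bar> \<le> 1"
      proof -
        have "norm (rGamma (- Complex \<gamma> \<tau>)) \<le> A" using that by (intro A) auto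
        then show ?thesis unfolding U_def norm_mult
          by (intro mult_mono \<Phi>_le) (auto intro: order_trans[OF norm_ge_zero])
      qed
      show "norm (U \<tau>) \<le> D * (w \<tau> * norm (\<Phi> \<tau>))" if "\<bar>\<tau>\<bar> > 1"
      proof -
        have "- Complex \<gamma> \<tau> = Complex (- \<gamma>) (- \<tau>)" by (simp add: complex_eq_iff)
        then have "norm (rGamma (- Complex \<gamma> \<tau>)) \<le> D * w \<tau>"
          using D[of "- \<tau>"] that by (simp add: w_def add.commute)
        then show ?thesis unfolding U_def norm_mult mult.assoc [symmetric]
          by (intro mult_right_mono) auto
      qed
    qed
  qed

  define R where "R = kernel_superposition \<gamma> \<Phi>"
  note super = \<gamma>(1) meas_\<Phi> int_U[unfolded U_def]
  have laplace_R: "laplace R p = complex_of_real (2 * pi) * laplace f p" if p: "p > 0" for p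
  proof -
    have "laplace R p = (exp (1 / of_real p) * complex_of_real (p powr \<gamma>)) * (complex_of_real (2 * pi) * G (- ln p))"
      unfolding R_def laplace_kernel_superposition[OF super p] inversion ..
    also have "G (- ln p) = complex_of_real (exp (- (\<gamma> * ln p)) * exp (- (1 / p))) * laplace f p"
      using p by (simp add: G_def fourier_density_def exp_minus inverse_eq_divide exp_diff)
    also have "(exp (1 / of_real p) * complex_of_real (p powr \<gamma>))
        * (complex_of_real (2 * pi) * (complex_of_real (exp (- (\<gamma> * ln p)) * exp (- (1 / p))) * laplace f p))
       = complex_of_real ((exp (1 / p) * exp (- (1 / p))) * (p powr \<gamma> * exp (- (\<gamma> * ln p)))) * (complex_of_real (2 * pi) * laplace f p)"
      using exp_of_real[of "1 / p", where ?'a = complex] by (simp add: mult_ac)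
    also have "(exp (1 / p) * exp (- (1 / p))) * (p powr \<gamma> * exp (- (\<gamma> * ln p))) = 1"
      using p by (simp add: powr_def exp_add [symmetric])
    finally show ?thesis by simp
  qed

  have f_eq: "f t = 1 / complex_of_real (2 * pi) * R t" if t: "t > 0" for t
  proof -
    have "f t - 1 / complex_of_real (2 * pi) * R t = 0"
    proof (rule laplace_injective[OF _ _ _ t])
      show "continuous_on {0<..} (\<lambda>t. f t - 1 / complex_of_real (2 * pi) * R t)"
        by (intro continuous_intros cont continuous_on_kernel_superposition[OF super, folded R_def]) auto
    next
      fix p :: real assume p: "p > 0"
      have eq: "complex_of_real (exp (- (p * t))) * (f t - 1 / complex_of_real (2 * pi) * R t)
         = complex_of_real (exp (- (p * t))) * f t - 1 / complex_of_real (2 * pi) * (complex_of_real (exp (- (p * t))) * R t)" for t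
        by (simp add: right_diff_distrib mult_ac)
      have int_R': "set_integrable lborel {0<..} (\<lambda>t. 1 / complex_of_real (2 * pi) * (complex_of_real (exp (- (p * t))) * R t))"
        by (intro set_integrable_mult_right laplace_integrable_kernel_superposition[OF super, folded R_def] p)
      note diff = set_integral_diff[OF laplace_integrable[OF regular p] int_R']
      show "set_integrable lborel {0<..} (\<lambda>t. complex_of_real (exp (- (p * t))) * (f t - 1 / complex_of_real (2 * pi) * R t))"
        unfolding eq by (rule diff(1))
      show "(LINT t:{0<..}|lborel. complex_of_real (exp (- (p * t))) * (f t - 1 / complex_of_real (2 * pi) * R t)) = 0"
        unfolding eq using diff(2) laplace_R[OF p] by (simp add: laplace_def)
    qed
    then show ?thesis by simp
  qed

  show ?thesis
  proof (intro allI impI conjI)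
    fix t :: real assume t: "t > 0"
    have kernel: "bessel_I (- (1 + Complex \<gamma> \<tau>)) (2 * sqrt t) * complex_of_real t powr (- (1 + Complex \<gamma> \<tau>) / 2) * F_transform f (Complex \<gamma> \<tau>)
        = inv_kernel (Complex \<gamma> \<tau>) t * \<Phi> \<tau>" for \<tau>
      using inv_kernel_eq_bessel[of "Complex \<gamma> \<tau>" t] \<gamma> t by (simp add: \<Phi>_def)
    show "L1_vline \<gamma> (\<lambda>z. bessel_I (- (1 + z)) (2 * sqrt t) *
                         complex_of_real t powr (- (1 + z) / 2) * F_transform f z)"
      unfolding L1_vline_def kernel by (rule integrable_kernel_superposition[OF super t])
    have "vline_integral \<gamma> (\<lambda>z. bessel_I (- (1 + z)) (2 * sqrt t) *
                         complex_of_real t powr (- (1 + z) / 2) * F_transform f z) = R t * \<i>"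
      unfolding vline_integral_def kernel R_def kernel_superposition_def by (rule integral_mult_left_zero)
    then show "f t = 1 / (2 * complex_of_real pi * \<i>) *
             vline_integral \<gamma> (\<lambda>z. bessel_I (- (1 + z)) (2 * sqrt t) *
                         complex_of_real t powr (- (1 + z) / 2) * F_transform f z)"
      using f_eq[OF t] by simp
  qed
qed

end
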